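(* For any abelian category $\mathcal C$ with infinite direct sums, the category $Ch^+(\mathcal C)$ of chain complexes in $\mathcal C$ concentrated in non-negative degrees and the category $\mathcal C_\omega$ of $\omega$-categories in $\mathcal C$ are equivalent.
   Context: Chain complexes have differentials lowering degree by one. An $\omega$-category in a category $\mathcal C$ with fibered products is an object $X$ of $\mathcal C$ with morphisms $s_n,t_n:X\to X$ ($n\in\mathbb N=\{0,1,2,\dots\}$) and composition morphisms $*_n:X\times_XX\to X$, where $X\times_XX$ is the fibered product of $s_n$ (on the first factor) and $t_n$ (on the second factor), satisfying the following axioms, written with generalized elements and with $\rho_i,\sigma_i\in\{s_i,t_i\}$ arbitrary: (1) for all $i$: $\rho_i\sigma_i=\sigma_i$; $a*_is_i(a)=t_i(a)*_ia=a$; $(a*_ib)*_ic=a*_i(b*_ic)$; $s_i(a*_ib)=s_ib$ and $t_i(a*_ib)=t_ia$; (2) for all $i<j$: $\rho_j\sigma_i=\sigma_i$; $\sigma_i\rho_j=\sigma_i$; $\rho_j(a*_ib)=\rho_ja*_i\rho_jb$; $(a*_jb)*_i(\alpha*_j\beta)=(a*_i\alpha)*_j(b*_i\beta)$ whenever both sides are defined; (3) $X$ is the colimit of the increasing sequence of its subobjects $X_n=\operatorname{im}(s_n)$, $n\in\mathbb N$. Morphisms of $\omega$-categories in $\mathcal C$ are morphisms in $\mathcal C$ commuting with all source, target and composition morphisms; this defines $\mathcal C_\omega$. *)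

theory Defs
  imports "HOL-Algebra.Group"
begin

section \<open>Categories, functors and equivalences\<close>

record ('o, 'm) category =
  Obj :: "'o set"
  Arr :: "'m set"
  Dom :: "'m \<Rightarrow> 'o"
  Cod :: "'m \<Rightarrow> 'o"
  Id :: "'o \<Rightarrow> 'm"
  Comp :: "'m \<Rightarrow> 'm \<Rightarrow> 'm"  (infixr "\<cdot>\<index>" 70)

definition Hom :: "('o, 'm, 'z) category_scheme \<Rightarrow> 'o \<Rightarrow> 'o \<Rightarrow> 'm set" where
  "Hom C A B = {f \<in> Arr C. Dom C f = A \<and> Cod C f = B}"

text \<open>The operations are total functions on the ambient types; they are constrained only on
  objects and on composable arrows, where \<open>g \<cdot> f\<close> means \<open>g\<close> after \<open>f\<close>.\<close>

locale category =
  fixes C :: "('o, 'm, 'z) category_scheme" (structure)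
  assumes Dom_Obj: "f \<in> Arr C \<Longrightarrow> Dom C f \<in> Obj C"
    and Cod_Obj: "f \<in> Arr C \<Longrightarrow> Cod C f \<in> Obj C"
    and Id_Hom: "A \<in> Obj C \<Longrightarrow> Id C A \<in> Hom C A A"
    and Comp_Hom: "\<lbrakk>f \<in> Hom C A B; g \<in> Hom C B D\<rbrakk> \<Longrightarrow> g \<cdot> f \<in> Hom C A D"
    and Id_left: "f \<in> Hom C A B \<Longrightarrow> Id C B \<cdot> f = f"
    and Id_right: "f \<in> Hom C A B \<Longrightarrow> f \<cdot> Id C A = f"
    and Comp_assoc: "\<lbrakk>f \<in> Hom C A B; g \<in> Hom C B D; h \<in> Hom C D E\<rbrakk>
                      \<Longrightarrow> (h \<cdot> g) \<cdot> f = h \<cdot> (g \<cdot> f)"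

definition is_mono :: "('o, 'm, 'z) category_scheme \<Rightarrow> 'm \<Rightarrow> bool" where
  "is_mono C m \<longleftrightarrow> m \<in> Arr C \<and>
     (\<forall>T. \<forall>f \<in> Hom C T (Dom C m). \<forall>g \<in> Hom C T (Dom C m).
        m \<cdot>\<^bsub>C\<^esub> f = m \<cdot>\<^bsub>C\<^esub> g \<longrightarrow> f = g)"

definition is_epi :: "('o, 'm, 'z) category_scheme \<Rightarrow> 'm \<Rightarrow> bool" where
  "is_epi C e \<longleftrightarrow> e \<in> Arr C \<and>
     (\<forall>T. \<forall>f \<in> Hom C (Cod C e) T. \<forall>g \<in> Hom C (Cod C e) T.
        f \<cdot>\<^bsub>C\<^esub> e = g \<cdot>\<^bsub>C\<^esub> e \<longrightarrow> f = g)"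

definition is_iso :: "('o, 'm, 'z) category_scheme \<Rightarrow> 'm \<Rightarrow> bool" where
  "is_iso C f \<longleftrightarrow> f \<in> Arr C \<and>
     (\<exists>g \<in> Hom C (Cod C f) (Dom C f).
        g \<cdot>\<^bsub>C\<^esub> f = Id C (Dom C f) \<and> f \<cdot>\<^bsub>C\<^esub> g = Id C (Cod C f))"

definition is_functor ::
  "('o, 'm, 'y) category_scheme \<Rightarrow> ('p, 'n, 'z) category_scheme
    \<Rightarrow> ('o \<Rightarrow> 'p) \<Rightarrow> ('m \<Rightarrow> 'n) \<Rightarrow> bool" where
  "is_functor A B Fo Fa \<longleftrightarrow>
     category A \<and> category B \<and>
     (\<forall>X \<in> Obj A. Fo X \<in> Obj B) \<and>
     (\<forall>X Y. \<forall>f \<in> Hom A X Y. Fa f \<in> Hom B (Fo X) (Fo Y)) \<and>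
     (\<forall>X \<in> Obj A. Fa (Id A X) = Id B (Fo X)) \<and>
     (\<forall>X Y Z. \<forall>f \<in> Hom A X Y. \<forall>g \<in> Hom A Y Z. Fa (g \<cdot>\<^bsub>A\<^esub> f) = Fa g \<cdot>\<^bsub>B\<^esub> Fa f)"

definition is_natural_iso ::
  "('o, 'm, 'y) category_scheme \<Rightarrow> ('p, 'n, 'z) category_scheme
    \<Rightarrow> ('o \<Rightarrow> 'p) \<Rightarrow> ('m \<Rightarrow> 'n) \<Rightarrow> ('o \<Rightarrow> 'p) \<Rightarrow> ('m \<Rightarrow> 'n) \<Rightarrow> ('o \<Rightarrow> 'n) \<Rightarrow> bool" where
  "is_natural_iso A B Fo Fa Go Ga \<eta> \<longleftrightarrow>
     (\<forall>X \<in> Obj A. \<eta> X \<in> Hom B (Fo X) (Go X) \<and> is_iso B (\<eta> X)) \<and>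
     (\<forall>X Y. \<forall>f \<in> Hom A X Y. \<eta> Y \<cdot>\<^bsub>B\<^esub> Fa f = Ga f \<cdot>\<^bsub>B\<^esub> \<eta> X)"

definition equivalent_categories ::
  "('o, 'm, 'y) category_scheme \<Rightarrow> ('p, 'n, 'z) category_scheme \<Rightarrow> bool" where
  "equivalent_categories A B \<longleftrightarrow>
     (\<exists>Fo Fa Go Ga \<eta> \<epsilon>.
        is_functor A B Fo Fa \<and> is_functor B A Go Ga \<and>
        is_natural_iso A A id id (Go \<circ> Fo) (Ga \<circ> Fa) \<eta> \<and>
        is_natural_iso B B (Fo \<circ> Go) (Fa \<circ> Ga) id id \<epsilon>)"


section \<open>Universal constructions\<close>

definition is_zero_object :: "('o, 'm, 'z) category_scheme \<Rightarrow> 'o \<Rightarrow> bool" where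
  "is_zero_object C Z \<longleftrightarrow> Z \<in> Obj C \<and>
     (\<forall>A \<in> Obj C. (\<exists>!f. f \<in> Hom C Z A) \<and> (\<exists>!f. f \<in> Hom C A Z))"

definition is_product ::
  "('o, 'm, 'z) category_scheme \<Rightarrow> 'o \<Rightarrow> 'o \<Rightarrow> 'o \<Rightarrow> 'm \<Rightarrow> 'm \<Rightarrow> bool" where
  "is_product C A B P p q \<longleftrightarrow>
     P \<in> Obj C \<and> p \<in> Hom C P A \<and> q \<in> Hom C P B \<and>
     (\<forall>T. \<forall>a \<in> Hom C T A. \<forall>b \<in> Hom C T B.
        \<exists>!h. h \<in> Hom C T P \<and> p \<cdot>\<^bsub>C\<^esub> h = a \<and> q \<cdot>\<^bsub>C\<^esub> h = b)"

definition is_coproduct ::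
  "('o, 'm, 'z) category_scheme \<Rightarrow> 'i set \<Rightarrow> ('i \<Rightarrow> 'o) \<Rightarrow> 'o \<Rightarrow> ('i \<Rightarrow> 'm) \<Rightarrow> bool" where
  "is_coproduct C I A S \<iota> \<longleftrightarrow>
     S \<in> Obj C \<and> (\<forall>i \<in> I. \<iota> i \<in> Hom C (A i) S) \<and>
     (\<forall>Z \<in> Obj C. \<forall>f. (\<forall>i \<in> I. f i \<in> Hom C (A i) Z) \<longrightarrow>
        (\<exists>!h. h \<in> Hom C S Z \<and> (\<forall>i \<in> I. h \<cdot>\<^bsub>C\<^esub> \<iota> i = f i)))"

text \<open>Every family of objects indexed by a set of elements of type \<open>'i\<close> has a direct sum.\<close>

definition has_direct_sums :: "('o, 'm, 'z) category_scheme \<Rightarrow> 'i itself \<Rightarrow> bool" where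
  "has_direct_sums C (TYPE('i)) \<longleftrightarrow>
     (\<forall>(I :: 'i set) A. (\<forall>i \<in> I. A i \<in> Obj C) \<longrightarrow> (\<exists>S \<iota>. is_coproduct C I A S \<iota>))"

definition is_pullback ::
  "('o, 'm, 'z) category_scheme \<Rightarrow> 'm \<Rightarrow> 'm \<Rightarrow> 'o \<Rightarrow> 'm \<Rightarrow> 'm \<Rightarrow> bool" where
  "is_pullback C f g P p q \<longleftrightarrow>
     P \<in> Obj C \<and> p \<in> Hom C P (Dom C f) \<and> q \<in> Hom C P (Dom C g) \<and> f \<cdot>\<^bsub>C\<^esub> p = g \<cdot>\<^bsub>C\<^esub> q \<and>
     (\<forall>T. \<forall>a \<in> Hom C T (Dom C f). \<forall>b \<in> Hom C T (Dom C g). f \<cdot>\<^bsub>C\<^esub> a = g \<cdot>\<^bsub>C\<^esub> b \<longrightarrow>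
        (\<exists>!h. h \<in> Hom C T P \<and> p \<cdot>\<^bsub>C\<^esub> h = a \<and> q \<cdot>\<^bsub>C\<^esub> h = b))"

text \<open>A fixed choice of fibered product for each cospan that has one, with its two projections.\<close>

definition fibprod :: "('o, 'm, 'z) category_scheme \<Rightarrow> 'm \<Rightarrow> 'm \<Rightarrow> 'o \<times> 'm \<times> 'm" where
  "fibprod C f g = (SOME (P, p, q). is_pullback C f g P p q)"

definition fp_obj :: "('o, 'm, 'z) category_scheme \<Rightarrow> 'm \<Rightarrow> 'm \<Rightarrow> 'o" where
  "fp_obj C f g = fst (fibprod C f g)"

definition fp_fst :: "('o, 'm, 'z) category_scheme \<Rightarrow> 'm \<Rightarrow> 'm \<Rightarrow> 'm" where
  "fp_fst C f g = fst (snd (fibprod C f g))"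

definition fp_snd :: "('o, 'm, 'z) category_scheme \<Rightarrow> 'm \<Rightarrow> 'm \<Rightarrow> 'm" where
  "fp_snd C f g = snd (snd (fibprod C f g))"

text \<open>The arrow \<open>\<langle>a, b\<rangle>\<close> into the fibered product; meaningful when \<open>f \<cdot> a = g \<cdot> b\<close>.\<close>

definition fp_pair :: "('o, 'm, 'z) category_scheme \<Rightarrow> 'm \<Rightarrow> 'm \<Rightarrow> 'm \<Rightarrow> 'm \<Rightarrow> 'm" where
  "fp_pair C f g a b =
     (THE h. h \<in> Hom C (Dom C a) (fp_obj C f g) \<and>
             fp_fst C f g \<cdot>\<^bsub>C\<^esub> h = a \<and> fp_snd C f g \<cdot>\<^bsub>C\<^esub> h = b)"

text \<open>\<open>m : I \<rightarrow> Cod f\<close> is the smallest subobject through which \<open>f\<close> factors.\<close>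

definition is_image :: "('o, 'm, 'z) category_scheme \<Rightarrow> 'm \<Rightarrow> 'o \<Rightarrow> 'm \<Rightarrow> bool" where
  "is_image C f I m \<longleftrightarrow>
     m \<in> Hom C I (Cod C f) \<and> is_mono C m \<and> (\<exists>e \<in> Hom C (Dom C f) I. m \<cdot>\<^bsub>C\<^esub> e = f) \<and>
     (\<forall>J. \<forall>m' \<in> Hom C J (Cod C f). \<forall>e' \<in> Hom C (Dom C f) J.
        is_mono C m' \<and> m' \<cdot>\<^bsub>C\<^esub> e' = f \<longrightarrow> (\<exists>u \<in> Hom C I J. m' \<cdot>\<^bsub>C\<^esub> u = m))"

definition is_sequential_colimit ::
  "('o, 'm, 'z) category_scheme \<Rightarrow> (nat \<Rightarrow> 'o) \<Rightarrow> (nat \<Rightarrow> 'm) \<Rightarrow> 'o \<Rightarrow> (nat \<Rightarrow> 'm) \<Rightarrow> bool" where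
  "is_sequential_colimit C D u X \<iota> \<longleftrightarrow>
     X \<in> Obj C \<and>
     (\<forall>n. u n \<in> Hom C (D n) (D (Suc n))) \<and>
     (\<forall>n. \<iota> n \<in> Hom C (D n) X \<and> \<iota> (Suc n) \<cdot>\<^bsub>C\<^esub> u n = \<iota> n) \<and>
     (\<forall>Z \<in> Obj C. \<forall>f. (\<forall>n. f n \<in> Hom C (D n) Z \<and> f (Suc n) \<cdot>\<^bsub>C\<^esub> u n = f n) \<longrightarrow>
        (\<exists>!h. h \<in> Hom C X Z \<and> (\<forall>n. h \<cdot>\<^bsub>C\<^esub> \<iota> n = f n)))"


section \<open>Abelian categories\<close>

record ('o, 'm) preadditive = "('o, 'm) category" +
  Add :: "'m \<Rightarrow> 'm \<Rightarrow> 'm"  (infixl "\<oplus>\<index>" 65)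
  Zero :: "'o \<Rightarrow> 'o \<Rightarrow> 'm"

definition hom_group :: "('o, 'm, 'z) preadditive_scheme \<Rightarrow> 'o \<Rightarrow> 'o \<Rightarrow> 'm monoid" where
  "hom_group C A B = \<lparr>carrier = Hom C A B, monoid.mult = Add C, one = Zero C A B\<rparr>"

locale preadditive_category = category C for C :: "('o, 'm, 'z) preadditive_scheme" (structure) +
  assumes hom_comm_group: "\<lbrakk>A \<in> Obj C; B \<in> Obj C\<rbrakk> \<Longrightarrow> comm_group (hom_group C A B)"
    and Comp_Add_left: "\<lbrakk>f \<in> Hom C A B; g \<in> Hom C B D; h \<in> Hom C B D\<rbrakk>
                         \<Longrightarrow> (g \<oplus> h) \<cdot> f = (g \<cdot> f) \<oplus> (h \<cdot> f)"
    and Comp_Add_right: "\<lbrakk>f \<in> Hom C A B; g \<in> Hom C A B; h \<in> Hom C B D\<rbrakk>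
                          \<Longrightarrow> h \<cdot> (f \<oplus> g) = (h \<cdot> f) \<oplus> (h \<cdot> g)"

definition is_kernel :: "('o, 'm, 'z) preadditive_scheme \<Rightarrow> 'm \<Rightarrow> 'o \<Rightarrow> 'm \<Rightarrow> bool" where
  "is_kernel C f K k \<longleftrightarrow>
     K \<in> Obj C \<and> k \<in> Hom C K (Dom C f) \<and> f \<cdot>\<^bsub>C\<^esub> k = Zero C K (Cod C f) \<and>
     (\<forall>T. \<forall>a \<in> Hom C T (Dom C f). f \<cdot>\<^bsub>C\<^esub> a = Zero C T (Cod C f) \<longrightarrow>
        (\<exists>!h. h \<in> Hom C T K \<and> k \<cdot>\<^bsub>C\<^esub> h = a))"

definition is_cokernel :: "('o, 'm, 'z) preadditive_scheme \<Rightarrow> 'm \<Rightarrow> 'o \<Rightarrow> 'm \<Rightarrow> bool" where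
  "is_cokernel C f Q q \<longleftrightarrow>
     Q \<in> Obj C \<and> q \<in> Hom C (Cod C f) Q \<and> q \<cdot>\<^bsub>C\<^esub> f = Zero C (Dom C f) Q \<and>
     (\<forall>T. \<forall>a \<in> Hom C (Cod C f) T. a \<cdot>\<^bsub>C\<^esub> f = Zero C (Dom C f) T \<longrightarrow>
        (\<exists>!h. h \<in> Hom C Q T \<and> h \<cdot>\<^bsub>C\<^esub> q = a))"

locale abelian_category = preadditive_category +
  assumes has_zero_object: "\<exists>Z. is_zero_object C Z"
    and has_products: "\<lbrakk>A \<in> Obj C; B \<in> Obj C\<rbrakk> \<Longrightarrow> \<exists>P p q. is_product C A B P p q"
    and has_kernels: "f \<in> Arr C \<Longrightarrow> \<exists>K k. is_kernel C f K k"
    and has_cokernels: "f \<in> Arr C \<Longrightarrow> \<exists>Q q. is_cokernel C f Q q"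
    and mono_is_kernel: "is_mono C m \<Longrightarrow> \<exists>f \<in> Arr C. Dom C f = Cod C m \<and> is_kernel C f (Dom C m) m"
    and epi_is_cokernel: "is_epi C e \<Longrightarrow> \<exists>f \<in> Arr C. Cod C f = Dom C e \<and> is_cokernel C f (Cod C e) e"


section \<open>Chain complexes\<close>

text \<open>An arrow of a category of structured objects carries its source and target, so that each
  arrow has a well-defined domain and codomain.\<close>

datatype ('x, 'f) arrow = Arrow (asrc: 'x) (atgt: 'x) (amap: 'f)

record ('o, 'm) complex_data =
  Deg :: "int \<Rightarrow> 'o"
  Diff :: "int \<Rightarrow> 'm"

definition chain_complex ::
  "('o, 'm, 'z) preadditive_scheme \<Rightarrow> ('o, 'm) complex_data \<Rightarrow> bool" where
  "chain_complex C K \<longleftrightarrow>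
     (\<forall>k. Deg K k \<in> Obj C) \<and>
     (\<forall>k. Diff K k \<in> Hom C (Deg K k) (Deg K (k - 1))) \<and>
     (\<forall>k. Diff K (k - 1) \<cdot>\<^bsub>C\<^esub> Diff K k = Zero C (Deg K k) (Deg K (k - 2)))"

definition nonneg_complex ::
  "('o, 'm, 'z) preadditive_scheme \<Rightarrow> ('o, 'm) complex_data \<Rightarrow> bool" where
  "nonneg_complex C K \<longleftrightarrow> chain_complex C K \<and> (\<forall>k < 0. is_zero_object C (Deg K k))"

definition chain_map ::
  "('o, 'm, 'z) preadditive_scheme \<Rightarrow> ('o, 'm) complex_data \<Rightarrow> ('o, 'm) complex_data
    \<Rightarrow> (int \<Rightarrow> 'm) \<Rightarrow> bool" where
  "chain_map C K L \<phi> \<longleftrightarrow>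
     (\<forall>k. \<phi> k \<in> Hom C (Deg K k) (Deg L k)) \<and>
     (\<forall>k. \<phi> (k - 1) \<cdot>\<^bsub>C\<^esub> Diff K k = Diff L k \<cdot>\<^bsub>C\<^esub> \<phi> k)"

definition Ch_nonneg ::
  "('o, 'm, 'z) preadditive_scheme
    \<Rightarrow> (('o, 'm) complex_data, (('o, 'm) complex_data, int \<Rightarrow> 'm) arrow) category" where
  "Ch_nonneg C =
     \<lparr>Obj = {K. nonneg_complex C K},
      Arr = {\<phi>. nonneg_complex C (asrc \<phi>) \<and> nonneg_complex C (atgt \<phi>) \<and>
                chain_map C (asrc \<phi>) (atgt \<phi>) (amap \<phi>)},
      Dom = asrc,
      Cod = atgt,
      Id = (\<lambda>K. Arrow K K (\<lambda>k. Id C (Deg K k))),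
      Comp = (\<lambda>\<psi> \<phi>. Arrow (asrc \<phi>) (atgt \<psi>) (\<lambda>k. amap \<psi> k \<cdot>\<^bsub>C\<^esub> amap \<phi> k))\<rparr>"


section \<open>\<open>\<omega>\<close>-categories in a category\<close>

record ('o, 'm) omega_data =
  Und :: 'o
  Src :: "nat \<Rightarrow> 'm"
  Tgt :: "nat \<Rightarrow> 'm"
  Cmp :: "nat \<Rightarrow> 'm"

text \<open>\<open>a\<close> and \<open>b\<close> are generalized elements of \<open>X\<close> (with a common domain) such that
  \<open>(a, b)\<close> is a generalized element of the \<open>n\<close>-th fibered product.\<close>

definition composable ::
  "('o, 'm, 'z) category_scheme \<Rightarrow> ('o, 'm) omega_data \<Rightarrow> nat \<Rightarrow> 'm \<Rightarrow> 'm \<Rightarrow> bool" where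
  "composable C X n a b \<longleftrightarrow>
     (\<exists>T. a \<in> Hom C T (Und X) \<and> b \<in> Hom C T (Und X)) \<and> Src X n \<cdot>\<^bsub>C\<^esub> a = Tgt X n \<cdot>\<^bsub>C\<^esub> b"

definition star ::
  "('o, 'm, 'z) category_scheme \<Rightarrow> ('o, 'm) omega_data \<Rightarrow> nat \<Rightarrow> 'm \<Rightarrow> 'm \<Rightarrow> 'm" where
  "star C X n a b = Cmp X n \<cdot>\<^bsub>C\<^esub> fp_pair C (Src X n) (Tgt X n) a b"

text \<open>Intended for categories \<open>C\<close> with fibered products, which every abelian category has;
  otherwise the chosen \<open>fibprod\<close> is arbitrary. Axioms are stated on generalized elements
  \<open>a : T \<rightarrow> X\<close> for all \<open>T\<close>. In \<open>exhaustive\<close>, \<open>\<iota> (Suc n) \<cdot> u n = \<iota> n\<close> (part of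
  \<open>is_sequential_colimit\<close>) makes \<open>u n\<close> the inclusion of subobjects \<open>im s_n \<rightarrow> im s_(n+1)\<close>.\<close>

locale omega_category = category C
  for C :: "('o, 'm, 'z) category_scheme" (structure) and X :: "('o, 'm) omega_data" +
  assumes Und_Obj: "Und X \<in> Obj C"
    and Src_Hom: "Src X n \<in> Hom C (Und X) (Und X)"
    and Tgt_Hom: "Tgt X n \<in> Hom C (Und X) (Und X)"
    and Cmp_Hom: "Cmp X n \<in> Hom C (fp_obj C (Src X n) (Tgt X n)) (Und X)"
    and bdry_same: "\<lbrakk>\<rho> \<in> {Src X i, Tgt X i}; \<sigma> \<in> {Src X i, Tgt X i}\<rbrakk> \<Longrightarrow> \<rho> \<cdot> \<sigma> = \<sigma>"
    and star_Src: "a \<in> Hom C T (Und X) \<Longrightarrow> star C X i a (Src X i \<cdot> a) = a"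
    and Tgt_star: "a \<in> Hom C T (Und X) \<Longrightarrow> star C X i (Tgt X i \<cdot> a) a = a"
    and star_assoc: "\<lbrakk>composable C X i a b; composable C X i b c\<rbrakk>
                      \<Longrightarrow> star C X i (star C X i a b) c = star C X i a (star C X i b c)"
    and Src_star_same: "composable C X i a b \<Longrightarrow> Src X i \<cdot> star C X i a b = Src X i \<cdot> b"
    and Tgt_star_same: "composable C X i a b \<Longrightarrow> Tgt X i \<cdot> star C X i a b = Tgt X i \<cdot> a"
    and bdry_upper: "\<lbrakk>i < j; \<rho> \<in> {Src X j, Tgt X j}; \<sigma> \<in> {Src X i, Tgt X i}\<rbrakk> \<Longrightarrow> \<rho> \<cdot> \<sigma> = \<sigma>"
    and bdry_lower: "\<lbrakk>i < j; \<rho> \<in> {Src X j, Tgt X j}; \<sigma> \<in> {Src X i, Tgt X i}\<rbrakk> \<Longrightarrow> \<sigma> \<cdot> \<rho> = \<sigma>"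
    and bdry_star: "\<lbrakk>i < j; \<rho> \<in> {Src X j, Tgt X j}; composable C X i a b\<rbrakk>
                     \<Longrightarrow> \<rho> \<cdot> star C X i a b = star C X i (\<rho> \<cdot> a) (\<rho> \<cdot> b)"
    and interchange: "\<lbrakk>i < j;
                       composable C X j a b; composable C X j \<alpha> \<beta>;
                       composable C X i (star C X j a b) (star C X j \<alpha> \<beta>);
                       composable C X i a \<alpha>; composable C X i b \<beta>;
                       composable C X j (star C X i a \<alpha>) (star C X i b \<beta>)\<rbrakk>
                      \<Longrightarrow> star C X i (star C X j a b) (star C X j \<alpha> \<beta>)
                        = star C X j (star C X i a \<alpha>) (star C X i b \<beta>)"
    and exhaustive: "\<exists>D u \<iota>. (\<forall>n. is_image C (Src X n) (D n) (\<iota> n)) \<and>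
                             is_sequential_colimit C D u (Und X) \<iota>"

definition omega_map ::
  "('o, 'm, 'z) category_scheme \<Rightarrow> ('o, 'm) omega_data \<Rightarrow> ('o, 'm) omega_data \<Rightarrow> 'm \<Rightarrow> bool" where
  "omega_map C X Y f \<longleftrightarrow>
     f \<in> Hom C (Und X) (Und Y) \<and>
     (\<forall>n. f \<cdot>\<^bsub>C\<^esub> Src X n = Src Y n \<cdot>\<^bsub>C\<^esub> f) \<and>
     (\<forall>n. f \<cdot>\<^bsub>C\<^esub> Tgt X n = Tgt Y n \<cdot>\<^bsub>C\<^esub> f) \<and>
     (\<forall>n. f \<cdot>\<^bsub>C\<^esub> Cmp X n =
          star C Y n (f \<cdot>\<^bsub>C\<^esub> fp_fst C (Src X n) (Tgt X n)) (f \<cdot>\<^bsub>C\<^esub> fp_snd C (Src X n) (Tgt X n)))"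

definition Omega_Cat ::
  "('o, 'm, 'z) category_scheme
    \<Rightarrow> (('o, 'm) omega_data, (('o, 'm) omega_data, 'm) arrow) category" where
  "Omega_Cat C =
     \<lparr>Obj = {X. omega_category C X},
      Arr = {\<phi>. omega_category C (asrc \<phi>) \<and> omega_category C (atgt \<phi>) \<and>
                omega_map C (asrc \<phi>) (atgt \<phi>) (amap \<phi>)},
      Dom = asrc,
      Cod = atgt,
      Id = (\<lambda>X. Arrow X X (Id C (Und X))),
      Comp = (\<lambda>\<psi> \<phi>. Arrow (asrc \<phi>) (atgt \<psi>) (amap \<psi> \<cdot>\<^bsub>C\<^esub> amap \<phi>))\<rparr>"

end

theory Submission
  imports Defs
begin

text \<open>In an additive category every composition \<open>*\<^sub>n\<close> is a homomorphism on generalized elements, and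
  splitting a composable pair as \<open>(a, b) = (a, s\<^sub>n a) + (0, b - s\<^sub>n a)\<close> forces
  \<open>a *\<^sub>n b = a + b - s\<^sub>n a\<close>. So an \<open>\<omega>\<close>-category is an object with endomorphisms \<open>s\<^sub>n, t\<^sub>n\<close>. The
  differences \<open>s\<^sub>n - s\<^sub>n\<^sub>-\<^sub>1\<close> are orthogonal idempotents, and exhaustiveness says that \<open>X\<close> is the direct
  sum of their images \<open>K\<^sub>n\<close>; the \<open>t\<^sub>n\<close> amount to a differential \<open>K\<^sub>n\<^sub>+\<^sub>1 \<rightarrow> K\<^sub>n\<close>. Conversely, a complex
  \<open>K\<close> gives \<open>\<Sum>\<^sub>n K\<^sub>n\<close> with \<open>s\<^sub>n\<close> the truncation to degrees \<open>\<le> n\<close> and \<open>t\<^sub>n\<close> the truncation plus the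
  differential on degree \<open>n + 1\<close>. The triples (complex, \<open>\<omega>\<close>-category, direct sum decomposition) form
  a span of categories, both legs of which are fully faithful and surjective on objects.\<close>

section \<open>Equivalences from spans\<close>

text \<open>Neither functor of the equivalence is canonical: from a complex one must choose a direct
  sum, from an \<omega>-category a splitting of each idempotent. A span absorbs these choices into
  its apex, so that functoriality and naturality become instances of uniqueness of partners and no
  computation touches the chosen objects. Additivity of \<open>*\<^sub>n\<close> holds because
  pairing into a fibered product is additive and composition with the arrow \<open>Cmp X n\<close>
  distributes over sums; the unit laws then evaluate both summands, since \<open>s\<^sub>n a\<close>
  is the right unit of \<open>a\<close>, and \<open>0\<close> is the left unit of
  \<open>b - s\<^sub>n a\<close>, whose target vanishes. The exhaustion axiom is the delicate one,
  as it speaks of images and their colimit: it is restated as a universal property of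
  \<open>X\<close> and its endomorphisms \<open>s\<^sub>n\<close>, which matches that of a direct
  sum through partial sums. Hom-sets carry an addition but no subtraction symbol; differences are
  therefore solutions \<open>d\<close> of \<open>d \<oplus> g = f\<close>, and identities are proved
  after adding the missing terms to both sides.\<close>

text \<open>\<open>M v w f \<phi>\<close> says that \<open>f\<close> and \<open>\<phi>\<close> underlie the same morphism \<open>v \<rightarrow> w\<close> of the apex.\<close>

locale category_span = A: category A + B: category B
  for A :: "('o, 'm, 'y) category_scheme" and B :: "('p, 'n, 'z) category_scheme" +
  fixes W :: "'w set" and a :: "'w \<Rightarrow> 'o" and b :: "'w \<Rightarrow> 'p"
    and M :: "'w \<Rightarrow> 'w \<Rightarrow> 'm \<Rightarrow> 'n \<Rightarrow> bool"
  assumes a_Obj: "w \<in> W \<Longrightarrow> a w \<in> Obj A" and b_Obj: "w \<in> W \<Longrightarrow> b w \<in> Obj B"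
    and a_surj: "X \<in> Obj A \<Longrightarrow> \<exists>w\<in>W. a w = X" and b_surj: "Y \<in> Obj B \<Longrightarrow> \<exists>w\<in>W. b w = Y"
    and M_left: "\<lbrakk>v \<in> W; w \<in> W; f \<in> Hom A (a v) (a w)\<rbrakk>
                  \<Longrightarrow> \<exists>!\<phi>. \<phi> \<in> Hom B (b v) (b w) \<and> M v w f \<phi>"
    and M_right: "\<lbrakk>v \<in> W; w \<in> W; \<phi> \<in> Hom B (b v) (b w)\<rbrakk>
                  \<Longrightarrow> \<exists>!f. f \<in> Hom A (a v) (a w) \<and> M v w f \<phi>"
    and M_Id: "w \<in> W \<Longrightarrow> M w w (Id A (a w)) (Id B (b w))"
    and M_Comp: "\<lbrakk>u \<in> W; v \<in> W; w \<in> W;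
                  f \<in> Hom A (a u) (a v); \<phi> \<in> Hom B (b u) (b v); M u v f \<phi>;
                  g \<in> Hom A (a v) (a w); \<psi> \<in> Hom B (b v) (b w); M v w g \<psi>\<rbrakk>
                  \<Longrightarrow> M u w (g \<cdot>\<^bsub>A\<^esub> f) (\<psi> \<cdot>\<^bsub>B\<^esub> \<phi>)"
begin

lemma swap: "category_span B A W b a (\<lambda>v w \<phi> f. M v w f \<phi>)"
  by unfold_locales (fact a_Obj b_Obj a_surj b_surj M_left M_right M_Id | blast intro: M_Comp)+

definition wit :: "'o \<Rightarrow> 'w" where
  "wit X = (SOME w. w \<in> W \<and> a w = X)"

definition obj_map :: "'o \<Rightarrow> 'p" where
  "obj_map X = b (wit X)"

definition arr_map :: "'m \<Rightarrow> 'n" where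
  "arr_map f = (THE \<phi>. \<phi> \<in> Hom B (obj_map (Dom A f)) (obj_map (Cod A f)) \<and>
                      M (wit (Dom A f)) (wit (Cod A f)) f \<phi>)"

lemma wit: assumes "X \<in> Obj A" shows "wit X \<in> W" "a (wit X) = X"
  using a_surj[OF assms] someI_ex[of "\<lambda>w. w \<in> W \<and> a w = X"]
  unfolding wit_def by blast+

lemma Hom_Obj: "f \<in> Hom A X Y \<Longrightarrow> X \<in> Obj A \<and> Y \<in> Obj A"
  using A.Dom_Obj A.Cod_Obj by (auto simp: Hom_def)

lemma arr_map:
  assumes "f \<in> Hom A X Y"
  shows "arr_map f \<in> Hom B (obj_map X) (obj_map Y)" "M (wit X) (wit Y) f (arr_map f)"
proof -
  have XY: "X \<in> Obj A" "Y \<in> Obj A" and D: "Dom A f = X" "Cod A f = Y"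
    using Hom_Obj[OF assms] assms by (auto simp: Hom_def)
  have "\<exists>!\<phi>. \<phi> \<in> Hom B (obj_map X) (obj_map Y) \<and> M (wit X) (wit Y) f \<phi>"
    unfolding obj_map_def using M_left[of "wit X" "wit Y" f] assms XY by (simp add: wit)
  from theI'[OF this]
  show "arr_map f \<in> Hom B (obj_map X) (obj_map Y)" "M (wit X) (wit Y) f (arr_map f)"
    unfolding arr_map_def D by auto
qed

lemma M_unique_left:
  assumes "v \<in> W" "w \<in> W" "M v w f \<phi>" "M v w g \<phi>" "f \<in> Hom A (a v) (a w)" "g \<in> Hom A (a v) (a w)"
    "\<phi> \<in> Hom B (b v) (b w)"
  shows "f = g"
  using M_right[OF assms(1,2,7)] assms by blast

lemma M_unique_right:
  assumes "v \<in> W" "w \<in> W" "M v w f \<phi>" "M v w f \<psi>" "\<phi> \<in> Hom B (b v) (b w)" "\<psi> \<in> Hom B (b v) (b w)"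
    "f \<in> Hom A (a v) (a w)"
  shows "\<phi> = \<psi>"
  using M_left[OF assms(1,2,7)] assms by blast

text \<open>Both functor laws come from uniqueness of partners: \<open>M_Id\<close> and
  \<open>M_Comp\<close> exhibit the identity and the composite as partners of the arrow to which
  \<open>arr_map\<close> is applied.\<close>

lemma is_functor: "is_functor A B obj_map arr_map"
  unfolding is_functor_def
proof (intro conjI ballI allI)
  show "category A" "category B" by unfold_locales
  show "obj_map X \<in> Obj B" if "X \<in> Obj A" for X
    using that by (simp add: obj_map_def b_Obj wit)
  show "arr_map f \<in> Hom B (obj_map X) (obj_map Y)" if "f \<in> Hom A X Y" for X Y f
    using arr_map[OF that] by simp
  show "arr_map (Id A X) = Id B (obj_map X)" if X: "X \<in> Obj A" for X
  proof (rule M_unique_right[of "wit X" "wit X" "Id A X"])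
    show "M (wit X) (wit X) (Id A X) (Id B (obj_map X))"
      using M_Id[of "wit X"] X by (simp add: wit obj_map_def)
    show "Id B (obj_map X) \<in> Hom B (b (wit X)) (b (wit X))"
      using X by (simp add: obj_map_def B.Id_Hom b_Obj wit)
  qed (use arr_map[OF A.Id_Hom[OF X]] A.Id_Hom[OF X] X in \<open>auto simp: wit obj_map_def\<close>)
  show "arr_map (g \<cdot>\<^bsub>A\<^esub> f) = arr_map g \<cdot>\<^bsub>B\<^esub> arr_map f"
    if f: "f \<in> Hom A X Y" and g: "g \<in> Hom A Y Z" for X Y Z f g
  proof (rule M_unique_right[of "wit X" "wit Z" "g \<cdot>\<^bsub>A\<^esub> f"])
    have O: "X \<in> Obj A" "Y \<in> Obj A" "Z \<in> Obj A" using Hom_Obj f g by blast+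
    show "M (wit X) (wit Z) (g \<cdot>\<^bsub>A\<^esub> f) (arr_map g \<cdot>\<^bsub>B\<^esub> arr_map f)"
      using M_Comp[of "wit X" "wit Y" "wit Z" f "arr_map f" g "arr_map g"] O f g
        arr_map[OF f] arr_map[OF g] by (simp add: wit obj_map_def)
    show "arr_map g \<cdot>\<^bsub>B\<^esub> arr_map f \<in> Hom B (b (wit X)) (b (wit Z))"
      using B.Comp_Hom[OF arr_map(1)[OF f] arr_map(1)[OF g]] by (simp add: obj_map_def)
    show "wit X \<in> W" "wit Z \<in> W" using O by (auto simp: wit)
    show "g \<cdot>\<^bsub>A\<^esub> f \<in> Hom A (a (wit X)) (a (wit Z))"
      using A.Comp_Hom[OF f g] O by (simp add: wit)
  qed (use arr_map[OF A.Comp_Hom[OF f g]] in \<open>auto simp: obj_map_def\<close>)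
qed

text \<open>\<open>P\<close> and \<open>Q\<close> lift two functors to the apex so that both lie
  over the same object of \<open>B\<close>. The component at \<open>X\<close> is the arrow whose
  partner is the identity there, its inverse is the arrow the other way with the same partner, and
  naturality holds because both sides of the square are partners of \<open>H f\<close>.\<close>

lemma natural_iso_of_witnesses:
  assumes P: "\<And>X. X \<in> Obj A \<Longrightarrow> P X \<in> W" "\<And>X. X \<in> Obj A \<Longrightarrow> a (P X) = Fo X"
    and Q: "\<And>X. X \<in> Obj A \<Longrightarrow> Q X \<in> W" "\<And>X. X \<in> Obj A \<Longrightarrow> a (Q X) = Go X"
    and eq: "\<And>X. X \<in> Obj A \<Longrightarrow> b (P X) = b (Q X)"
    and F: "\<And>X Y f. f \<in> Hom A X Y \<Longrightarrow> Fa f \<in> Hom A (Fo X) (Fo Y)"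
    and G: "\<And>X Y f. f \<in> Hom A X Y \<Longrightarrow> Ga f \<in> Hom A (Go X) (Go Y)"
    and H: "\<And>X Y f. f \<in> Hom A X Y \<Longrightarrow>
              H f \<in> Hom B (b (P X)) (b (P Y)) \<and> M (P X) (P Y) (Fa f) (H f) \<and> M (Q X) (Q Y) (Ga f) (H f)"
  shows "\<exists>\<eta>. is_natural_iso A A Fo Fa Go Ga \<eta>"
proof -
  have ex: "\<exists>f. f \<in> Hom A (a v) (a w) \<and> M v w f (Id B (b v))"
    if "v \<in> W" "w \<in> W" "b v = b w" for v w
    using M_right[OF that(1,2), of "Id B (b v)"] that B.Id_Hom[OF b_Obj] by auto
  define \<eta> where "\<eta> X = (SOME f. f \<in> Hom A (a (P X)) (a (Q X)) \<and> M (P X) (Q X) f (Id B (b (P X))))" for X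
  have \<eta>: "\<eta> X \<in> Hom A (Fo X) (Go X)" "M (P X) (Q X) (\<eta> X) (Id B (b (P X)))" if "X \<in> Obj A" for X
    using someI_ex[OF ex[of "P X" "Q X"]] that P Q eq unfolding \<eta>_def by auto
  have Idb: "Id B (b (P X)) \<in> Hom B (b (P X)) (b (P X))" if "X \<in> Obj A" for X
    using that by (simp add: B.Id_Hom b_Obj P)
  have "is_iso A (\<eta> X)" if X: "X \<in> Obj A" for X
  proof -
    obtain \<theta> where \<theta>: "\<theta> \<in> Hom A (Go X) (Fo X)" "M (Q X) (P X) \<theta> (Id B (b (Q X)))"
      using ex[of "Q X" "P X"] X P Q eq by auto
    note w = P(1)[OF X] Q(1)[OF X] and [simp] = P(2)[OF X] Q(2)[OF X] eq[OF X]
    note I = Idb[OF X, simplified]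
    have II: "Id B (b (Q X)) \<cdot>\<^bsub>B\<^esub> Id B (b (Q X)) = Id B (b (Q X))" using B.Id_left[OF I] .
    have FG: "Fo X \<in> Obj A" "Go X \<in> Obj A" using Hom_Obj \<theta>(1) by blast+
    have "M (P X) (P X) (\<theta> \<cdot>\<^bsub>A\<^esub> \<eta> X) (Id B (b (Q X)))"
      using M_Comp[OF w w(1), of "\<eta> X" "Id B (b (Q X))" \<theta> "Id B (b (Q X))"] \<eta>[OF X] \<theta> I II by simp
    then have 1: "\<theta> \<cdot>\<^bsub>A\<^esub> \<eta> X = Id A (Fo X)"
      using M_unique_left[OF w(1) w(1)] M_Id[OF w(1)] A.Comp_Hom[OF \<eta>(1)[OF X] \<theta>(1)]
        A.Id_Hom[OF FG(1)] I by simp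
    have "M (Q X) (Q X) (\<eta> X \<cdot>\<^bsub>A\<^esub> \<theta>) (Id B (b (Q X)))"
      using M_Comp[OF w(2) w, of \<theta> "Id B (b (Q X))" "\<eta> X" "Id B (b (Q X))"] \<eta>[OF X] \<theta> I II by simp
    then have 2: "\<eta> X \<cdot>\<^bsub>A\<^esub> \<theta> = Id A (Go X)"
      using M_unique_left[OF w(2) w(2)] M_Id[OF w(2)] A.Comp_Hom[OF \<theta>(1) \<eta>(1)[OF X]]
        A.Id_Hom[OF FG(2)] I by simp
    show ?thesis using \<eta>(1)[OF X] \<theta>(1) 1 2 unfolding is_iso_def by (auto simp: Hom_def)
  qed
  moreover have "\<eta> Y \<cdot>\<^bsub>A\<^esub> Fa f = Ga f \<cdot>\<^bsub>A\<^esub> \<eta> X" if f: "f \<in> Hom A X Y" for X Y f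
  proof -
    have O: "X \<in> Obj A" "Y \<in> Obj A" using Hom_Obj[OF f] by auto
    note [simp] = P(2)[OF O(1)] Q(2)[OF O(1)] eq[OF O(1)] P(2)[OF O(2)] Q(2)[OF O(2)] eq[OF O(2)]
    note Hf = H[OF f, simplified]
    have "M (P X) (Q Y) (\<eta> Y \<cdot>\<^bsub>A\<^esub> Fa f) (Id B (b (Q Y)) \<cdot>\<^bsub>B\<^esub> H f)"
      by (rule M_Comp[where v = "P Y"]) (use O P Q \<eta>[OF O(2)] F[OF f] Hf Idb[OF O(2)] in auto)
    then have 1: "M (P X) (Q Y) (\<eta> Y \<cdot>\<^bsub>A\<^esub> Fa f) (H f)"
      using B.Id_left[of "H f" "b (Q X)" "b (Q Y)"] Hf by simp
    have "M (P X) (Q Y) (Ga f \<cdot>\<^bsub>A\<^esub> \<eta> X) (H f \<cdot>\<^bsub>B\<^esub> Id B (b (Q X)))"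
      by (rule M_Comp[where v = "Q X"]) (use O P Q \<eta>[OF O(1)] G[OF f] Hf Idb[OF O(1)] in auto)
    then have 2: "M (P X) (Q Y) (Ga f \<cdot>\<^bsub>A\<^esub> \<eta> X) (H f)"
      using B.Id_right[of "H f" "b (Q X)" "b (Q Y)"] Hf by simp
    show ?thesis
      by (rule M_unique_left[OF _ _ 1 2])
        (use O P Q Hf A.Comp_Hom[OF \<eta>(1)[OF O(1)] G[OF f]] A.Comp_Hom[OF F[OF f] \<eta>(1)[OF O(2)]] in auto)
  qed
  ultimately show ?thesis using \<eta>(1) unfolding is_natural_iso_def by blast
qed

end

text \<open>The unit compares the apex objects \<open>wit X\<close> and
  \<open>S.wit (obj_map X)\<close>, both of which lie over \<open>obj_map X\<close>; the counit is
  the analogous comparison in the swapped span.\<close>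

lemma (in category_span) equivalent: "equivalent_categories A B"
proof -
  interpret S: category_span B A W b a "\<lambda>v w \<phi> f. M v w f \<phi>" by (rule swap)
  have O: "obj_map X \<in> Obj B" if "X \<in> Obj A" for X
    using that by (simp add: obj_map_def b_Obj wit)
  have SO: "S.obj_map X \<in> Obj A" if "X \<in> Obj B" for X
    using that by (simp add: S.obj_map_def a_Obj S.wit)
  have arr: "S.arr_map f \<in> Hom A (a (wit (a (S.wit X)))) (a (wit (a (S.wit Y))))"
    if "f \<in> Hom B X Y" for X Y f
    using S.arr_map(1)[OF that] S.Hom_Obj[OF that] SO by (simp add: S.obj_map_def wit)
  have "\<exists>\<eta>. is_natural_iso A A id id (S.obj_map \<circ> obj_map) (S.arr_map \<circ> arr_map) \<eta>"
    by (rule natural_iso_of_witnesses[where P = wit and Q = "S.wit \<circ> obj_map" and H = arr_map])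
      (use O in \<open>auto simp: wit S.wit obj_map_def S.obj_map_def dest: Hom_Obj arr_map S.arr_map[OF arr_map(1)]\<close>)
  moreover have "\<exists>\<epsilon>. is_natural_iso B B (obj_map \<circ> S.obj_map) (arr_map \<circ> S.arr_map) id id \<epsilon>"
    by (rule S.natural_iso_of_witnesses[where Q = S.wit and P = "wit \<circ> S.obj_map" and H = S.arr_map])
      (use SO arr in \<open>auto simp: wit S.wit obj_map_def S.obj_map_def dest: S.arr_map arr_map[OF S.arr_map(1)]\<close>)
  ultimately show ?thesis
    unfolding equivalent_categories_def using is_functor S.is_functor by blast
qed

section \<open>Calculus of arrows\<close>

context category
begin

declare Dom_Obj [simp] Cod_Obj [simp]

lemma comp_simps [simp]:
  assumes "f \<in> Arr C" "g \<in> Arr C" "Cod C f = Dom C g"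
  shows "g \<cdot> f \<in> Arr C" "Dom C (g \<cdot> f) = Dom C f" "Cod C (g \<cdot> f) = Cod C g"
  using Comp_Hom[of f "Dom C f" "Dom C g" g "Cod C g"] assms by (auto simp: Hom_def)

lemma Id_simps [simp]:
  assumes "A \<in> Obj C"
  shows "Id C A \<in> Arr C" "Dom C (Id C A) = A" "Cod C (Id C A) = A"
  using Id_Hom[OF assms] by (auto simp: Hom_def)

lemma comp_Id [simp]:
  assumes "f \<in> Arr C"
  shows "Cod C f = B \<Longrightarrow> Id C B \<cdot> f = f" "Dom C f = A \<Longrightarrow> f \<cdot> Id C A = f"
  using Id_left[of f "Dom C f" "Cod C f"] Id_right[of f "Dom C f" "Cod C f"] assms
  by (auto simp: Hom_def)

lemma comp_assoc [simp]:
  assumes "f \<in> Arr C" "g \<in> Arr C" "h \<in> Arr C" "Cod C f = Dom C g" "Cod C g = Dom C h"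
  shows "(h \<cdot> g) \<cdot> f = h \<cdot> (g \<cdot> f)"
  using Comp_assoc[of f "Dom C f" "Cod C f" g "Cod C g" h "Cod C h"] assms by (auto simp: Hom_def)

end

section \<open>Addition and zero arrows\<close>

context preadditive_category
begin

lemma hom_group:
  assumes "A \<in> Obj C" "B \<in> Obj C"
  shows "comm_group (hom_group C A B)" "carrier (hom_group C A B) = Hom C A B"
    "mult (hom_group C A B) = Add C" "one (hom_group C A B) = Zero C A B"
  using hom_comm_group[OF assms] by (auto simp: hom_group_def)

lemma zero_simps [simp]:
  assumes "A \<in> Obj C" "B \<in> Obj C"
  shows "Zero C A B \<in> Arr C" "Dom C (Zero C A B) = A" "Cod C (Zero C A B) = B"
  using monoid.one_closed[OF group.is_monoid[OF comm_group.axioms(2)[OF hom_group(1)[OF assms]]]]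
    hom_group[OF assms] by (auto simp: Hom_def)

context
  fixes f g
  assumes par: "f \<in> Arr C" "g \<in> Arr C" "Dom C g = Dom C f" "Cod C g = Cod C f"
begin

interpretation G: comm_group "hom_group C (Dom C f) (Cod C f)"
  rewrites "carrier (hom_group C (Dom C f) (Cod C f)) = Hom C (Dom C f) (Cod C f)"
    and "mult (hom_group C (Dom C f) (Cod C f)) = Add C"
    and "one (hom_group C (Dom C f) (Cod C f)) = Zero C (Dom C f) (Cod C f)"
  using par hom_group[of "Dom C f" "Cod C f"] by simp_all

lemma add_simps:
  "f \<oplus> g \<in> Arr C" "Dom C (f \<oplus> g) = Dom C f" "Cod C (f \<oplus> g) = Cod C f"
  using G.m_closed[of f g] par by (auto simp: Hom_def)

lemma add_commute: "f \<oplus> g = g \<oplus> f"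
  using G.m_comm[of f g] par by (auto simp: Hom_def)

lemma add_assoc:
  assumes "h \<in> Arr C" "Dom C h = Dom C f" "Cod C h = Cod C f"
  shows "(f \<oplus> g) \<oplus> h = f \<oplus> (g \<oplus> h)"
  using G.m_assoc[of f g h] par assms by (auto simp: Hom_def)

lemma add_left_commute:
  assumes "h \<in> Arr C" "Dom C h = Dom C f" "Cod C h = Cod C f"
  shows "f \<oplus> (g \<oplus> h) = g \<oplus> (f \<oplus> h)"
  using G.m_lcomm[of f g h] par assms by (auto simp: Hom_def)

lemma add_right_cancel:
  assumes "f \<oplus> h = g \<oplus> h" "h \<in> Arr C" "Dom C h = Dom C f" "Cod C h = Cod C f"
  shows "f = g"
  using G.right_cancel[of h f g] par assms by (auto simp: Hom_def)

text \<open>Stand-in for \<open>f - g\<close>; cancellation makes \<open>d\<close> unique, so this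
  equation is all that has to be known about it.\<close>

lemma difference_exists:
  "\<exists>d. d \<in> Arr C \<and> Dom C d = Dom C f \<and> Cod C d = Cod C f \<and> d \<oplus> g = f"
proof -
  have fg: "f \<in> Hom C (Dom C f) (Cod C f)" "g \<in> Hom C (Dom C f) (Cod C f)"
    using par by (auto simp: Hom_def)
  define i where "i = inv\<^bsub>hom_group C (Dom C f) (Cod C f)\<^esub> g"
  have i: "i \<in> Hom C (Dom C f) (Cod C f)" "i \<oplus> g = Zero C (Dom C f) (Cod C f)"
    using G.inv_closed[OF fg(2)] G.l_inv[OF fg(2)] by (auto simp: i_def)
  have "(f \<oplus> i) \<oplus> g = f"
    using G.m_assoc[OF fg(1) i(1) fg(2)] i(2) G.r_one[OF fg(1)] by simp
  then show ?thesis using G.m_closed[OF fg(1) i(1)] by (auto simp: Hom_def)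
qed

lemma add_zero:
  "Zero C (Dom C f) (Cod C f) \<oplus> f = f" "f \<oplus> Zero C (Dom C f) (Cod C f) = f"
  using G.l_one[of f] G.r_one[of f] par by (auto simp: Hom_def)

lemma add_left_eq_self:
  assumes "Dom C f = A" "Cod C f = B"
  shows "f \<oplus> g = g \<longleftrightarrow> f = Zero C A B"
  using G.right_cancel[of g f "Zero C (Dom C f) (Cod C f)"] G.l_one[of g] par G.one_closed assms
  by (auto simp: Hom_def)

end

lemmas add_ac = add_assoc add_commute add_left_commute

declare add_simps [simp]

lemma zero_add [simp]:
  assumes "f \<in> Arr C" "Dom C f = A" "Cod C f = B"
  shows "Zero C A B \<oplus> f = f" "f \<oplus> Zero C A B = f"
  using add_zero[of f f] assms by auto

lemma comp_add:
  assumes "f \<in> Arr C" "g \<in> Arr C" "h \<in> Arr C" "Dom C g = Dom C f" "Cod C g = Cod C f"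
  shows "Dom C f = Cod C h \<Longrightarrow> (f \<oplus> g) \<cdot> h = (f \<cdot> h) \<oplus> (g \<cdot> h)"
    and "Cod C f = Dom C h \<Longrightarrow> h \<cdot> (f \<oplus> g) = (h \<cdot> f) \<oplus> (h \<cdot> g)"
  using Comp_Add_left[of h "Dom C h" "Cod C h" f "Cod C f" g]
    Comp_Add_right[of f "Dom C f" "Cod C f" g h "Cod C h"] assms by (auto simp: Hom_def)

text \<open>Zero arrows are given as neutral elements, so absorption has to be derived: by
  bilinearity such a composite equals its own double.\<close>

lemma comp_zero [simp]:
  assumes "f \<in> Arr C"
  shows "Cod C f = A \<Longrightarrow> B \<in> Obj C \<Longrightarrow> Zero C A B \<cdot> f = Zero C (Dom C f) B"
    and "Dom C f = B \<Longrightarrow> A \<in> Obj C \<Longrightarrow> f \<cdot> Zero C A B = Zero C A (Cod C f)"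
proof -
  show "Zero C A B \<cdot> f = Zero C (Dom C f) B" if "Cod C f = A" "B \<in> Obj C"
    using add_left_eq_self[of "Zero C A B \<cdot> f" "Zero C A B \<cdot> f" "Dom C f" B]
      comp_add(1)[of "Zero C A B" "Zero C A B" f] assms that by auto
  show "f \<cdot> Zero C A B = Zero C A (Cod C f)" if "Dom C f = B" "A \<in> Obj C"
    using add_left_eq_self[of "f \<cdot> Zero C A B" "f \<cdot> Zero C A B" A "Cod C f"]
      comp_add(2)[of "Zero C A B" "Zero C A B" f] assms that by auto
qed

declare comp_add [simp]

lemma Hom_zero_object:
  assumes "is_zero_object C Z"
  shows "f \<in> Hom C Z A \<Longrightarrow> g \<in> Hom C Z A \<Longrightarrow> f = g" "f \<in> Hom C A Z \<Longrightarrow> g \<in> Hom C A Z \<Longrightarrow> f = g"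
proof -
  show "f = g" if "f \<in> Hom C Z A" "g \<in> Hom C Z A"
    using assms that Cod_Obj[of f] unfolding is_zero_object_def Hom_def by auto
  show "f = g" if "f \<in> Hom C A Z" "g \<in> Hom C A Z"
    using assms that Dom_Obj[of f] unfolding is_zero_object_def Hom_def by auto
qed

end

section \<open>Equalizers, split idempotents and fibered products\<close>

context abelian_category
begin

text \<open>The kernel of a difference \<open>d\<close> of \<open>f\<close> and \<open>g\<close>,
  since \<open>d \<cdot> a\<close> vanishes exactly when \<open>f\<close> and \<open>g\<close> agree
  on \<open>a\<close>.\<close>

lemma equalizer:
  assumes f: "f \<in> Hom C X Y" and g: "g \<in> Hom C X Y"
  obtains k where "k \<in> Arr C" "Cod C k = X" "f \<cdot> k = g \<cdot> k"
    "\<And>T a. a \<in> Hom C T X \<Longrightarrow> f \<cdot> a = g \<cdot> a \<Longrightarrow> \<exists>!h. h \<in> Hom C T (Dom C k) \<and> k \<cdot> h = a"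
proof -
  note fg = f[unfolded Hom_def, simplified] g[unfolded Hom_def, simplified]
  obtain d where d: "d \<in> Arr C" "Dom C d = X" "Cod C d = Y" "d \<oplus> g = f"
    using difference_exists[of f g] fg by auto
  have eq: "d \<cdot> a = Zero C T Y \<longleftrightarrow> f \<cdot> a = g \<cdot> a" if a: "a \<in> Hom C T X" for a T
  proof -
    have "f \<cdot> a = (d \<cdot> a) \<oplus> (g \<cdot> a)"
      using comp_add(1)[of d g a] a d fg by (simp add: Hom_def)
    then show ?thesis
      using add_left_eq_self[of "d \<cdot> a" "g \<cdot> a" T Y] a d fg by (simp add: Hom_def)
  qed
  obtain K k where K: "is_kernel C d K k" using has_kernels d(1) by blast
  then have k: "k \<in> Hom C K X" "d \<cdot> k = Zero C K Y"
    and un: "\<And>T a. a \<in> Hom C T X \<Longrightarrow> d \<cdot> a = Zero C T Y \<Longrightarrow> \<exists>!h. h \<in> Hom C T K \<and> k \<cdot> h = a"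
    by (simp_all add: is_kernel_def d)
  have [simp]: "Dom C k = K" using k by (simp add: Hom_def)
  show thesis
  proof (rule that[of k])
    show "k \<in> Arr C" "Cod C k = X" "f \<cdot> k = g \<cdot> k" using k eq by (auto simp: Hom_def)
    show "\<exists>!h. h \<in> Hom C T (Dom C k) \<and> k \<cdot> h = a"
      if "a \<in> Hom C T X" "f \<cdot> a = g \<cdot> a" for T a
      using un[OF that(1)] that(2) eq[OF that(1)] by simp
  qed
qed

text \<open>Splits through the equalizer \<open>k\<close> of \<open>e\<close> and the identity:
  \<open>e\<close> itself factors as \<open>k \<cdot> p\<close>, and \<open>p \<cdot> k\<close> is
  the identity because both solve \<open>k \<cdot> h = k\<close>.\<close>

lemma idempotent_splits:
  assumes e: "e \<in> Hom C X X" "e \<cdot> e = e"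
  obtains K i p where "K \<in> Obj C" "i \<in> Hom C K X" "p \<in> Hom C X K" "p \<cdot> i = Id C K" "i \<cdot> p = e"
proof -
  have e': "e \<in> Arr C" "Dom C e = X" "Cod C e = X" and X: "X \<in> Obj C"
    using e(1) Dom_Obj[of e] by (auto simp: Hom_def)
  obtain k where k: "k \<in> Arr C" "Cod C k = X" "e \<cdot> k = Id C X \<cdot> k"
    and un: "\<And>T a. a \<in> Hom C T X \<Longrightarrow> e \<cdot> a = Id C X \<cdot> a \<Longrightarrow>
              \<exists>!h. h \<in> Hom C T (Dom C k) \<and> k \<cdot> h = a"
    using equalizer[OF e(1) Id_Hom[OF X]] by blast
  obtain p where p: "p \<in> Hom C X (Dom C k)" "k \<cdot> p = e" using un[OF e(1)] e(2) e' by auto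
  have p': "p \<in> Arr C" "Dom C p = X" "Cod C p = Dom C k" using p by (auto simp: Hom_def)
  have "k \<cdot> (p \<cdot> k) = k" using comp_assoc[of k p k] k p p' by simp
  moreover have "\<exists>!h. h \<in> Hom C (Dom C k) (Dom C k) \<and> k \<cdot> h = k"
    using un[of k "Dom C k"] k by (simp add: Hom_def)
  moreover have "p \<cdot> k \<in> Hom C (Dom C k) (Dom C k)" "Id C (Dom C k) \<in> Hom C (Dom C k) (Dom C k)"
    using k p' by (auto simp: Hom_def)
  ultimately have "p \<cdot> k = Id C (Dom C k)"
    using k by (metis comp_Id(2))
  then show thesis using that[of "Dom C k" k p] k p by (simp add: Hom_def)
qed

text \<open>Built as the equalizer of \<open>f \<cdot> a\<close> and \<open>g \<cdot> b\<close> on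
  the product with projections \<open>a\<close> and \<open>b\<close>; existence is what gives
  meaning to the choice in \<open>fibprod\<close>.\<close>

lemma pullback_exists:
  assumes "f \<in> Arr C" "g \<in> Arr C" "Cod C g = Cod C f"
  shows "\<exists>P p q. is_pullback C f g P p q"
proof -
  obtain R a b where R: "is_product C (Dom C f) (Dom C g) R a b"
    using has_products assms by (meson Dom_Obj)
  have ab: "R \<in> Obj C" "a \<in> Arr C" "b \<in> Arr C" "Dom C a = R" "Dom C b = R"
    "Cod C a = Dom C f" "Cod C b = Dom C g"
    using R by (auto simp: is_product_def Hom_def)
  obtain k where k: "k \<in> Arr C" "Cod C k = R" "(f \<cdot> a) \<cdot> k = (g \<cdot> b) \<cdot> k"
    and un: "\<And>T u. u \<in> Hom C T R \<Longrightarrow> (f \<cdot> a) \<cdot> u = (g \<cdot> b) \<cdot> u \<Longrightarrow>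
              \<exists>!h. h \<in> Hom C T (Dom C k) \<and> k \<cdot> h = u"
    by (rule equalizer[of "f \<cdot> a" R "Cod C f" "g \<cdot> b"]) (use ab assms in \<open>auto simp: Hom_def\<close>)
  have "\<exists>!h. h \<in> Hom C T (Dom C k) \<and> (a \<cdot> k) \<cdot> h = x \<and> (b \<cdot> k) \<cdot> h = y"
    if x: "x \<in> Hom C T (Dom C f)" and y: "y \<in> Hom C T (Dom C g)" and xy: "f \<cdot> x = g \<cdot> y" for T x y
  proof -
    have ex1: "\<exists>!h. h \<in> Hom C T R \<and> a \<cdot> h = x \<and> b \<cdot> h = y"
      using R x y by (auto simp: is_product_def)
    then obtain u where u: "u \<in> Hom C T R" "a \<cdot> u = x" "b \<cdot> u = y" by blast
    have "\<exists>!h. h \<in> Hom C T (Dom C k) \<and> k \<cdot> h = u"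
      using un[OF u(1)] u xy ab assms by (simp add: Hom_def)
    moreover have "(a \<cdot> k) \<cdot> h = x \<and> (b \<cdot> k) \<cdot> h = y \<longleftrightarrow> k \<cdot> h = u"
      if h: "h \<in> Hom C T (Dom C k)" for h
    proof -
      have "k \<cdot> h \<in> Hom C T R" using h k ab by (auto simp: Hom_def)
      then have "a \<cdot> (k \<cdot> h) = x \<and> b \<cdot> (k \<cdot> h) = y \<longleftrightarrow> k \<cdot> h = u" using ex1 u by blast
      then show ?thesis using h k ab by (simp add: Hom_def)
    qed
    ultimately show ?thesis by metis
  qed
  then show ?thesis
    using k ab assms unfolding is_pullback_def
    by (intro exI[of _ "Dom C k"] exI[of _ "a \<cdot> k"] exI[of _ "b \<cdot> k"]) (auto simp: Hom_def)
qed

lemma fp_is_pullback: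
  assumes "f \<in> Arr C" "g \<in> Arr C" "Cod C g = Cod C f"
  shows "is_pullback C f g (fp_obj C f g) (fp_fst C f g) (fp_snd C f g)"
proof -
  have "\<exists>x. case x of (P, p, q) \<Rightarrow> is_pullback C f g P p q"
    using pullback_exists[OF assms] by auto
  from someI_ex[OF this] show ?thesis
    unfolding fp_obj_def fp_fst_def fp_snd_def fibprod_def by (auto split: prod.splits)
qed

context
  fixes f g
  assumes fg: "f \<in> Arr C" "g \<in> Arr C" "Cod C g = Cod C f"
begin

lemma fp_simps:
  "fp_obj C f g \<in> Obj C"
  "fp_fst C f g \<in> Arr C" "Dom C (fp_fst C f g) = fp_obj C f g" "Cod C (fp_fst C f g) = Dom C f"
  "fp_snd C f g \<in> Arr C" "Dom C (fp_snd C f g) = fp_obj C f g" "Cod C (fp_snd C f g) = Dom C g"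
  using fp_is_pullback[OF fg] by (auto simp: is_pullback_def Hom_def)

lemma fp_comm: "f \<cdot> fp_fst C f g = g \<cdot> fp_snd C f g"
  using fp_is_pullback[OF fg] by (auto simp: is_pullback_def)

lemma fp_universal:
  assumes "a \<in> Hom C T (Dom C f)" "b \<in> Hom C T (Dom C g)" "f \<cdot> a = g \<cdot> b"
  shows "\<exists>!h. h \<in> Hom C T (fp_obj C f g) \<and> fp_fst C f g \<cdot> h = a \<and> fp_snd C f g \<cdot> h = b"
  using fp_is_pullback[OF fg] assms by (simp add: is_pullback_def)

lemma fp_ext:
  assumes "h \<in> Arr C" "k \<in> Arr C" "Cod C h = fp_obj C f g" "Cod C k = fp_obj C f g" "Dom C k = Dom C h"
    "fp_fst C f g \<cdot> h = fp_fst C f g \<cdot> k" "fp_snd C f g \<cdot> h = fp_snd C f g \<cdot> k"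
  shows "h = k"
proof -
  let ?p = "fp_fst C f g" and ?q = "fp_snd C f g"
  have "f \<cdot> (?p \<cdot> h) = g \<cdot> (?q \<cdot> h)"
    using comp_assoc[of h ?p f] comp_assoc[of h ?q g] assms fp_simps fp_comm fg by simp
  then have "\<exists>!u. u \<in> Hom C (Dom C h) (fp_obj C f g) \<and> ?p \<cdot> u = ?p \<cdot> h \<and> ?q \<cdot> u = ?q \<cdot> h"
    by (intro fp_universal) (use assms fp_simps in \<open>simp_all add: Hom_def\<close>)
  moreover have "h \<in> Hom C (Dom C h) (fp_obj C f g)" "k \<in> Hom C (Dom C h) (fp_obj C f g)"
    using assms by (auto simp: Hom_def)
  ultimately show ?thesis using assms(6,7) by metis
qed

lemma fp_pair_simps:
  assumes "a \<in> Arr C" "b \<in> Arr C" "Dom C b = Dom C a" "Cod C a = Dom C f" "Cod C b = Dom C g"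
    "f \<cdot> a = g \<cdot> b"
  shows "fp_pair C f g a b \<in> Arr C" "Dom C (fp_pair C f g a b) = Dom C a"
    "Cod C (fp_pair C f g a b) = fp_obj C f g"
    "fp_fst C f g \<cdot> fp_pair C f g a b = a" "fp_snd C f g \<cdot> fp_pair C f g a b = b"
proof -
  have "\<exists>!h. h \<in> Hom C (Dom C a) (fp_obj C f g) \<and> fp_fst C f g \<cdot> h = a \<and> fp_snd C f g \<cdot> h = b"
    by (intro fp_universal) (use assms in \<open>simp_all add: Hom_def\<close>)
  from theI'[OF this]
  show "fp_pair C f g a b \<in> Arr C" "Dom C (fp_pair C f g a b) = Dom C a"
    "Cod C (fp_pair C f g a b) = fp_obj C f g"
    "fp_fst C f g \<cdot> fp_pair C f g a b = a" "fp_snd C f g \<cdot> fp_pair C f g a b = b"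
    unfolding fp_pair_def by (auto simp: Hom_def)
qed

lemma fp_pair_fst_snd: "fp_pair C f g (fp_fst C f g) (fp_snd C f g) = Id C (fp_obj C f g)"
  by (rule fp_ext) (use fp_simps fp_comm in \<open>simp_all add: fp_pair_simps\<close>)

text \<open>Both sides have the same two projections. Consequently an arrow out of the fibered
  product, applied to pairs, is additive in the pair.\<close>

lemma fp_pair_add:
  assumes "a \<in> Arr C" "b \<in> Arr C" "Dom C b = Dom C a" "Cod C a = Dom C f" "Cod C b = Dom C g"
    "f \<cdot> a = g \<cdot> b"
    and "c \<in> Arr C" "d \<in> Arr C" "Dom C c = Dom C a" "Dom C d = Dom C a"
    "Cod C c = Dom C f" "Cod C d = Dom C g" "f \<cdot> c = g \<cdot> d"
  shows "fp_pair C f g (a \<oplus> c) (b \<oplus> d) = fp_pair C f g a b \<oplus> fp_pair C f g c d"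
  by (rule fp_ext) (use assms fp_simps fg in \<open>simp_all add: fp_pair_simps\<close>)

end

end

section \<open>The linear form of an \<open>\<omega>\<close>-category\<close>

text \<open>The simplifier nests composites to the right, which hides a factor
  \<open>g \<cdot> f\<close> inside \<open>g \<cdot> (f \<cdot> x)\<close>; this makes an equation
  for that factor usable there.\<close>

lemma (in category) comp_reassoc:
  assumes "g \<cdot> f = h" "x \<in> Arr C" "f \<in> Arr C" "g \<in> Arr C" "Cod C x = Dom C f" "Cod C f = Dom C g"
  shows "g \<cdot> (f \<cdot> x) = h \<cdot> x"
  using comp_assoc[of x f g] assms by simp

text \<open>Since composition is a morphism of fibered products it is additive, which leaves only
  \<open>a *\<^sub>n b = a + b - s\<^sub>n a\<close>; the last assumption states this without subtraction.\<close>

locale linear_omega_category = abelian_category C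
  for C :: "('o, 'm, 'z) preadditive_scheme" (structure) and X :: "('o, 'm) omega_data" +
  assumes Und_Obj: "Und X \<in> Obj C"
    and Src_Hom: "Src X n \<in> Hom C (Und X) (Und X)"
    and Tgt_Hom: "Tgt X n \<in> Hom C (Und X) (Und X)"
    and Cmp_Hom: "Cmp X n \<in> Hom C (fp_obj C (Src X n) (Tgt X n)) (Und X)"
    and bdry_upper: "\<lbrakk>i \<le> j; \<rho> \<in> {Src X j, Tgt X j}; \<sigma> \<in> {Src X i, Tgt X i}\<rbrakk> \<Longrightarrow> \<rho> \<cdot> \<sigma> = \<sigma>"
    and bdry_lower: "\<lbrakk>i < j; \<rho> \<in> {Src X j, Tgt X j}; \<sigma> \<in> {Src X i, Tgt X i}\<rbrakk> \<Longrightarrow> \<sigma> \<cdot> \<rho> = \<sigma>"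
    and Cmp_add: "Cmp X n \<oplus> (Src X n \<cdot> fp_fst C (Src X n) (Tgt X n))
                   = fp_fst C (Src X n) (Tgt X n) \<oplus> fp_snd C (Src X n) (Tgt X n)"
begin

lemma und_simps [simp]:
  "Und X \<in> Obj C"
  "Src X n \<in> Arr C" "Dom C (Src X n) = Und X" "Cod C (Src X n) = Und X"
  "Tgt X n \<in> Arr C" "Dom C (Tgt X n) = Und X" "Cod C (Tgt X n) = Und X"
  using Und_Obj Src_Hom[of n] Tgt_Hom[of n] by (auto simp: Hom_def)

lemma bdry_simps [simp]:
  "i \<le> j \<Longrightarrow> Src X j \<cdot> Src X i = Src X i" "i \<le> j \<Longrightarrow> Src X j \<cdot> Tgt X i = Tgt X i"
  "i \<le> j \<Longrightarrow> Tgt X j \<cdot> Src X i = Src X i" "i \<le> j \<Longrightarrow> Tgt X j \<cdot> Tgt X i = Tgt X i"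
  "i < j \<Longrightarrow> Src X i \<cdot> Src X j = Src X i" "i < j \<Longrightarrow> Src X i \<cdot> Tgt X j = Src X i"
  "i < j \<Longrightarrow> Tgt X i \<cdot> Src X j = Tgt X i" "i < j \<Longrightarrow> Tgt X i \<cdot> Tgt X j = Tgt X i"
  by (simp_all add: bdry_upper bdry_lower)

lemma bdry_comp_simps [simp]:
  assumes "a \<in> Arr C" "Cod C a = Und X"
  shows "i \<le> j \<Longrightarrow> Src X j \<cdot> (Src X i \<cdot> a) = Src X i \<cdot> a"
    "i \<le> j \<Longrightarrow> Src X j \<cdot> (Tgt X i \<cdot> a) = Tgt X i \<cdot> a"
    "i \<le> j \<Longrightarrow> Tgt X j \<cdot> (Src X i \<cdot> a) = Src X i \<cdot> a"
    "i \<le> j \<Longrightarrow> Tgt X j \<cdot> (Tgt X i \<cdot> a) = Tgt X i \<cdot> a"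
    "i < j \<Longrightarrow> Src X i \<cdot> (Src X j \<cdot> a) = Src X i \<cdot> a"
    "i < j \<Longrightarrow> Src X i \<cdot> (Tgt X j \<cdot> a) = Src X i \<cdot> a"
    "i < j \<Longrightarrow> Tgt X i \<cdot> (Src X j \<cdot> a) = Tgt X i \<cdot> a"
    "i < j \<Longrightarrow> Tgt X i \<cdot> (Tgt X j \<cdot> a) = Tgt X i \<cdot> a"
  using assms by (auto intro: comp_reassoc)

lemmas bdry_fp = fp_simps[of "Src X n" "Tgt X n" for n, simplified]

lemma Cmp_simps:
  "Cmp X n \<in> Arr C" "Dom C (Cmp X n) = fp_obj C (Src X n) (Tgt X n)" "Cod C (Cmp X n) = Und X"
  using Cmp_Hom[of n] by (auto simp: Hom_def)

lemma composable_iff: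
  "composable C X n a b \<longleftrightarrow> a \<in> Arr C \<and> b \<in> Arr C \<and> Dom C b = Dom C a \<and>
     Cod C a = Und X \<and> Cod C b = Und X \<and> Src X n \<cdot> a = Tgt X n \<cdot> b"
  by (auto simp: composable_def Hom_def)

lemma star_simps:
  assumes "composable C X n a b"
  shows "star C X n a b \<in> Arr C" "Dom C (star C X n a b) = Dom C a" "Cod C (star C X n a b) = Und X"
    "star C X n a b \<oplus> (Src X n \<cdot> a) = a \<oplus> b"
proof -
  let ?s = "Src X n" and ?t = "Tgt X n"
  note ab = assms[unfolded composable_iff]
  have pair: "fp_pair C ?s ?t a b \<in> Arr C" "Dom C (fp_pair C ?s ?t a b) = Dom C a"
    "Cod C (fp_pair C ?s ?t a b) = fp_obj C ?s ?t"
    "fp_fst C ?s ?t \<cdot> fp_pair C ?s ?t a b = a" "fp_snd C ?s ?t \<cdot> fp_pair C ?s ?t a b = b"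
    using fp_pair_simps[of ?s ?t a b] ab by simp_all
  show "star C X n a b \<in> Arr C" "Dom C (star C X n a b) = Dom C a" "Cod C (star C X n a b) = Und X"
    unfolding star_def using pair Cmp_simps by simp_all
  have "(Cmp X n \<oplus> (?s \<cdot> fp_fst C ?s ?t)) \<cdot> fp_pair C ?s ?t a b = a \<oplus> b"
    unfolding Cmp_add using pair bdry_fp by simp
  then show "star C X n a b \<oplus> (?s \<cdot> a) = a \<oplus> b"
    using pair bdry_fp Cmp_simps by (simp add: star_def)
qed

text \<open>Cancellation characterises \<open>a + b - s\<^sub>n a\<close>; this is the entry point
  for equations with a composite on one side.\<close>

lemma star_eqI:
  assumes "composable C X n a b" "c \<in> Arr C" "Dom C c = Dom C a" "Cod C c = Und X"
    "c \<oplus> (Src X n \<cdot> a) = a \<oplus> b"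
  shows "star C X n a b = c"
  by (rule add_right_cancel[where h = "Src X n \<cdot> a"])
    (use assms star_simps[OF assms(1)] in \<open>simp_all add: composable_iff\<close>)

lemma Src_star_same:
  assumes "composable C X i a b"
  shows "Src X i \<cdot> star C X i a b = Src X i \<cdot> b"
proof (rule add_right_cancel[where h = "Src X i \<cdot> a"])
  note S = star_simps[OF assms]
  note ab = assms[unfolded composable_iff]
  have "Src X i \<cdot> (star C X i a b \<oplus> (Src X i \<cdot> a)) = Src X i \<cdot> (b \<oplus> a)"
    unfolding S(4) using ab by (simp add: add_commute)
  then show "(Src X i \<cdot> star C X i a b) \<oplus> (Src X i \<cdot> a) = (Src X i \<cdot> b) \<oplus> (Src X i \<cdot> a)"
    using S(1-3) ab by simp
qed (use star_simps[OF assms] assms in \<open>simp_all add: composable_iff\<close>)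

text \<open>Composability turns \<open>t\<^sub>i b\<close> into \<open>s\<^sub>i a\<close>, which
  cancels against the correction term, itself fixed by \<open>t\<^sub>i\<close>.\<close>

lemma Tgt_star_same:
  assumes "composable C X i a b"
  shows "Tgt X i \<cdot> star C X i a b = Tgt X i \<cdot> a"
proof (rule add_right_cancel[where h = "Src X i \<cdot> a"])
  note S = star_simps[OF assms]
  note ab = assms[unfolded composable_iff]
  have "Tgt X i \<cdot> (star C X i a b \<oplus> (Src X i \<cdot> a)) = Tgt X i \<cdot> (a \<oplus> b)"
    unfolding S(4) ..
  then show "(Tgt X i \<cdot> star C X i a b) \<oplus> (Src X i \<cdot> a) = (Tgt X i \<cdot> a) \<oplus> (Src X i \<cdot> a)"
    using S(1-3) ab by simp
qed (use star_simps[OF assms] assms in \<open>simp_all add: composable_iff\<close>)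

text \<open>In lower dimension \<open>a\<close> and \<open>b\<close> have the same boundary,
  \<open>\<sigma> a = \<sigma> s\<^sub>j a = \<sigma> t\<^sub>j b = \<sigma> b\<close>, and the
  terms \<open>a\<close> and \<open>s\<^sub>j a\<close> of the composite cancel.\<close>

lemma bdry_star_lower:
  assumes "i < j" "composable C X j a b" "\<sigma> \<in> {Src X i, Tgt X i}"
  shows "\<sigma> \<cdot> star C X j a b = \<sigma> \<cdot> b"
proof (rule add_right_cancel[where h = "\<sigma> \<cdot> a"])
  note S = star_simps[OF assms(2)]
  note ab = assms(2)[unfolded composable_iff]
  have "\<sigma> \<cdot> (star C X j a b \<oplus> (Src X j \<cdot> a)) = \<sigma> \<cdot> (b \<oplus> a)"
    unfolding S(4) using ab by (simp add: add_commute)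
  moreover have "\<sigma> \<cdot> a = \<sigma> \<cdot> b"
  proof -
    have "a \<in> Arr C" "Cod C a = Und X" "b \<in> Arr C" "Cod C b = Und X" using ab by simp_all
    then have "\<sigma> \<cdot> (Src X j \<cdot> a) = \<sigma> \<cdot> a" "\<sigma> \<cdot> (Tgt X j \<cdot> b) = \<sigma> \<cdot> b"
      using assms(1,3) by auto
    then show ?thesis using ab by simp
  qed
  ultimately show "(\<sigma> \<cdot> star C X j a b) \<oplus> (\<sigma> \<cdot> a) = (\<sigma> \<cdot> b) \<oplus> (\<sigma> \<cdot> a)"
    using S(1-3) ab assms(1,3) by auto
qed (use star_simps[OF assms(2)] assms in \<open>auto simp: composable_iff\<close>)

text \<open>Both sides are \<open>a + b + c - s\<^sub>i a - s\<^sub>i b\<close>, because the inner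
  composite on the left has source \<open>s\<^sub>i b\<close>.\<close>

lemma star_assoc:
  assumes "composable C X i a b" "composable C X i b c"
  shows "star C X i (star C X i a b) c = star C X i a (star C X i b c)"
proof (rule star_eqI)
  note ab = assms[unfolded composable_iff]
  let ?x = "star C X i a b" and ?y = "star C X i b c" and ?z = "star C X i a (star C X i b c)"
  note x = star_simps[OF assms(1)] and y = star_simps[OF assms(2)]
  show "composable C X i ?x c"
    using ab x Src_star_same[OF assms(1)] by (simp add: composable_iff)
  have cy: "composable C X i a ?y"
    using ab y Tgt_star_same[OF assms(2)] by (simp add: composable_iff)
  note z = star_simps[OF cy]
  show "?z \<in> Arr C" "Dom C ?z = Dom C ?x" "Cod C ?z = Und X" using x z by auto
  have "(?z \<oplus> (Src X i \<cdot> b)) \<oplus> (Src X i \<cdot> a) = (?z \<oplus> (Src X i \<cdot> a)) \<oplus> (Src X i \<cdot> b)"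
    using z(1-3) ab by (simp add: add_ac)
  also have "\<dots> = a \<oplus> (?y \<oplus> (Src X i \<cdot> b))"
    unfolding z(4) using y(1-3) ab by (simp add: add_ac)
  also have "\<dots> = (a \<oplus> b) \<oplus> c"
    unfolding y(4) using ab by (simp add: add_ac)
  also have "\<dots> = (?x \<oplus> c) \<oplus> (Src X i \<cdot> a)"
    unfolding x(4)[symmetric] using x(1-3) ab by (simp add: add_ac)
  finally have "?z \<oplus> (Src X i \<cdot> b) = ?x \<oplus> c"
    using add_right_cancel[of "?z \<oplus> (Src X i \<cdot> b)" "?x \<oplus> c" "Src X i \<cdot> a"] x(1-3) z(1-3) ab by simp
  then show "?z \<oplus> (Src X i \<cdot> ?x) = ?x \<oplus> c"
    using Src_star_same[OF assms(1)] by simp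
qed

text \<open>\<open>\<rho>\<close> is additive and commutes with \<open>s\<^sub>i\<close>, both
  products being \<open>s\<^sub>i\<close>.\<close>

lemma bdry_star:
  assumes "i < j" "\<rho> \<in> {Src X j, Tgt X j}" "composable C X i a b"
  shows "\<rho> \<cdot> star C X i a b = star C X i (\<rho> \<cdot> a) (\<rho> \<cdot> b)"
proof (rule star_eqI[symmetric])
  note S = star_simps[OF assms(3)]
  note ab = assms(3)[unfolded composable_iff]
  show "composable C X i (\<rho> \<cdot> a) (\<rho> \<cdot> b)"
    using assms(1,2) ab by (auto simp: composable_iff)
  show "\<rho> \<cdot> star C X i a b \<in> Arr C" "Dom C (\<rho> \<cdot> star C X i a b) = Dom C (\<rho> \<cdot> a)"
    "Cod C (\<rho> \<cdot> star C X i a b) = Und X"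
    using assms(2) S(1-3) ab by auto
  have "\<rho> \<cdot> (star C X i a b \<oplus> (Src X i \<cdot> a)) = \<rho> \<cdot> (a \<oplus> b)" unfolding S(4) ..
  then show "(\<rho> \<cdot> star C X i a b) \<oplus> (Src X i \<cdot> (\<rho> \<cdot> a)) = (\<rho> \<cdot> a) \<oplus> (\<rho> \<cdot> b)"
    using S(1-3) ab assms(1,2) by auto
qed

text \<open>Both sides are \<open>a + b + \<alpha> + \<beta> - s\<^sub>j a - s\<^sub>j \<alpha> -
  s\<^sub>i b\<close>. On the left the last term is the lower source of
  \<open>a *\<^sub>j b\<close>, known from \<open>bdry_star_lower\<close>; on the right the
  \<open>s\<^sub>i a\<close> subtracted in \<open>a *\<^sub>i \<alpha>\<close> cancels against the
  one in its \<open>s\<^sub>j\<close>-source.\<close>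

lemma interchange:
  assumes "i < j"
    and xc: "composable C X j a b" and yc: "composable C X j \<alpha> \<beta>"
    and "composable C X i (star C X j a b) (star C X j \<alpha> \<beta>)"
    and uc: "composable C X i a \<alpha>" and vc: "composable C X i b \<beta>"
    and zc: "composable C X j (star C X i a \<alpha>) (star C X i b \<beta>)"
  shows "star C X i (star C X j a b) (star C X j \<alpha> \<beta>) = star C X j (star C X i a \<alpha>) (star C X i b \<beta>)"
    (is "star C X i ?x ?y = star C X j ?u ?v")
proof (rule star_eqI[OF assms(4)])
  let ?z = "star C X j ?u ?v" and ?si = "Src X i" and ?sj = "Src X j"
  note x = star_simps[OF xc] and y = star_simps[OF yc] and u = star_simps[OF uc]
    and v = star_simps[OF vc] and z = star_simps[OF zc]
  note c = xc[unfolded composable_iff] yc[unfolded composable_iff] uc[unfolded composable_iff]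
  show "?z \<in> Arr C" "Dom C ?z = Dom C ?x" "Cod C ?z = Und X" using z x u by auto
  define x y u v z where xyz: "x = ?x" "y = ?y" "u = ?u" "v = ?v" "z = ?z"
  note X = x[folded xyz] y[folded xyz] u[folded xyz] v[folded xyz] z[folded xyz]
  have "?sj \<cdot> (u \<oplus> (?si \<cdot> a)) = ?sj \<cdot> (a \<oplus> \<alpha>)"
    by (simp add: X)
  then have u': "(?sj \<cdot> u) \<oplus> (?si \<cdot> a) = (?sj \<cdot> a) \<oplus> (?sj \<cdot> \<alpha>)"
    using X(9-11) c \<open>i < j\<close> by simp
  have "(z \<oplus> (?si \<cdot> b)) \<oplus> ((?sj \<cdot> a) \<oplus> (?sj \<cdot> \<alpha>)) = ((z \<oplus> (?sj \<cdot> u)) \<oplus> (?si \<cdot> b)) \<oplus> (?si \<cdot> a)"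
    unfolding u'[symmetric] using X(9-11,17-19) c by (simp add: add_ac)
  also have "\<dots> = (u \<oplus> (?si \<cdot> a)) \<oplus> (v \<oplus> (?si \<cdot> b))"
    unfolding X(20) using X(9-11,13-15) c by (simp add: add_ac)
  also have "\<dots> = (a \<oplus> b) \<oplus> (\<alpha> \<oplus> \<beta>)"
    unfolding X(12,16) using c by (simp add: add_ac)
  also have "\<dots> = (x \<oplus> y) \<oplus> ((?sj \<cdot> a) \<oplus> (?sj \<cdot> \<alpha>))"
    unfolding X(4,8)[symmetric] using X(1-3,5-7) c by (simp add: add_ac)
  finally have "z \<oplus> (?si \<cdot> b) = x \<oplus> y"
    using add_right_cancel[of "z \<oplus> (?si \<cdot> b)" "x \<oplus> y" "(?sj \<cdot> a) \<oplus> (?sj \<cdot> \<alpha>)"]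
      X(1-3,5-7,9-11,17-19) c by simp
  then show "?z \<oplus> (?si \<cdot> ?x) = ?x \<oplus> ?y"
    unfolding xyz using bdry_star_lower[OF \<open>i < j\<close> xc] by simp
qed

text \<open>The linear form says nothing about how the images of the \<open>s\<^sub>n\<close> fill
  \<open>X\<close>, so exhaustiveness remains a premise; the unit laws are instances of
  \<open>star_eqI\<close>.\<close>

lemma omega_categoryI:
  assumes "\<exists>D u \<iota>. (\<forall>n. is_image C (Src X n) (D n) (\<iota> n)) \<and> is_sequential_colimit C D u (Und X) \<iota>"
  shows "omega_category C X"
proof unfold_locales
  show "star C X i a (Src X i \<cdot> a) = a" if "a \<in> Hom C T (Und X)" for a T i
    by (rule star_eqI) (use that in \<open>simp_all add: composable_iff Hom_def\<close>)
  show "star C X i (Tgt X i \<cdot> a) a = a" if "a \<in> Hom C T (Und X)" for a T i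
    by (rule star_eqI) (use that in \<open>simp_all add: composable_iff Hom_def add_commute\<close>)
  show "\<rho> \<cdot> \<sigma> = \<sigma>" if "\<rho> \<in> {Src X i, Tgt X i}" "\<sigma> \<in> {Src X i, Tgt X i}" for \<rho> \<sigma> i
    using bdry_upper[of i i] that by blast
  show "\<rho> \<cdot> \<sigma> = \<sigma>" if "i < j" "\<rho> \<in> {Src X j, Tgt X j}" "\<sigma> \<in> {Src X i, Tgt X i}" for \<rho> \<sigma> i j
    using bdry_upper[of i j] that by simp
qed (fact Und_Obj Src_Hom Tgt_Hom Cmp_Hom bdry_lower assms Src_star_same Tgt_star_same
      star_assoc bdry_star interchange)+

end

lemma linear_omega_categoryI:
  assumes "abelian_category C" "omega_category C X"
  shows "linear_omega_category C X"
proof -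
  interpret abelian_category C by fact
  interpret X: omega_category C X by fact
  note X' = X.Und_Obj X.Src_Hom X.Tgt_Hom X.Cmp_Hom
  have [simp]: "Und X \<in> Obj C"
    "Src X n \<in> Arr C" "Dom C (Src X n) = Und X" "Cod C (Src X n) = Und X"
    "Tgt X n \<in> Arr C" "Dom C (Tgt X n) = Und X" "Cod C (Tgt X n) = Und X"
    "Cmp X n \<in> Arr C" "Dom C (Cmp X n) = fp_obj C (Src X n) (Tgt X n)" "Cod C (Cmp X n) = Und X" for n
    using X.Und_Obj X.Src_Hom[of n] X.Tgt_Hom[of n] X.Cmp_Hom[of n] by (auto simp: Hom_def)
  show ?thesis
  proof unfold_locales
    show "\<rho> \<cdot>\<^bsub>C\<^esub> \<sigma> = \<sigma>" if "i \<le> j" "\<rho> \<in> {Src X j, Tgt X j}" "\<sigma> \<in> {Src X i, Tgt X i}" for \<rho> \<sigma> i j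
      using X.bdry_same[of \<rho> i \<sigma>] X.bdry_upper[of i j \<rho> \<sigma>] that by (cases "i = j") auto
    fix n
    let ?s = "Src X n" and ?t = "Tgt X n"
    \<comment> \<open>The projections form the universal composable pair, so evaluating
      \<open>Cmp X n\<close> on them determines it.\<close>
    define P p q where Ppq: "P = fp_obj C ?s ?t" "p = fp_fst C ?s ?t" "q = fp_snd C ?s ?t"
    have pq [simp]: "P \<in> Obj C" "p \<in> Arr C" "Dom C p = P" "Cod C p = Und X"
      "q \<in> Arr C" "Dom C q = P" "Cod C q = Und X"
      using fp_simps[of ?s ?t] by (auto simp: Ppq)
    have spq: "?t \<cdot>\<^bsub>C\<^esub> q = ?s \<cdot>\<^bsub>C\<^esub> p" using fp_comm[of ?s ?t] by (simp add: Ppq)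
    have ts: "?t \<cdot>\<^bsub>C\<^esub> (?s \<cdot>\<^bsub>C\<^esub> p) = ?s \<cdot>\<^bsub>C\<^esub> p"
      by (rule comp_reassoc) (use X.bdry_same[of ?t n ?s] in auto)
    \<comment> \<open>\<open>c\<close> is \<open>q - s\<^sub>n p\<close>. Its target vanishes
      because \<open>t\<^sub>n q = s\<^sub>n p = t\<^sub>n s\<^sub>n p\<close>, which makes
      \<open>0\<close> its left unit.\<close>
    obtain c where c: "c \<in> Arr C" "Dom C c = P" "Cod C c = Und X" "c \<oplus>\<^bsub>C\<^esub> (?s \<cdot>\<^bsub>C\<^esub> p) = q"
      using difference_exists[of q "?s \<cdot>\<^bsub>C\<^esub> p"] by auto
    have "?t \<cdot>\<^bsub>C\<^esub> (c \<oplus>\<^bsub>C\<^esub> (?s \<cdot>\<^bsub>C\<^esub> p)) = ?s \<cdot>\<^bsub>C\<^esub> p" by (simp only: c(4) spq)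
    then have tc: "?t \<cdot>\<^bsub>C\<^esub> c = Zero C P (Und X)"
      using c(1-3) ts add_left_eq_self[of "?t \<cdot>\<^bsub>C\<^esub> c" "?s \<cdot>\<^bsub>C\<^esub> p" P "Und X"] by simp
    have 0: "star C X n (Zero C P (Und X)) c = c"
      using X.Tgt_star[of c P n] c(1-3) by (simp add: tc Hom_def)
    have 1: "star C X n p (?s \<cdot>\<^bsub>C\<^esub> p) = p"
      using X.star_Src[of p P n] by (simp add: Hom_def)
    have "Cmp X n = Cmp X n \<cdot>\<^bsub>C\<^esub> fp_pair C ?s ?t p q"
      using fp_pair_fst_snd[of ?s ?t] by (simp add: Ppq[symmetric])
    also have "fp_pair C ?s ?t p q = fp_pair C ?s ?t (Zero C P (Und X) \<oplus>\<^bsub>C\<^esub> p) (c \<oplus>\<^bsub>C\<^esub> (?s \<cdot>\<^bsub>C\<^esub> p))"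
      using c(4) by simp
    also have "\<dots> = fp_pair C ?s ?t (Zero C P (Und X)) c \<oplus>\<^bsub>C\<^esub> fp_pair C ?s ?t p (?s \<cdot>\<^bsub>C\<^esub> p)"
      by (rule fp_pair_add) (use c(1-3) tc ts in simp_all)
    also have "Cmp X n \<cdot>\<^bsub>C\<^esub> \<dots> = c \<oplus>\<^bsub>C\<^esub> p"
      using fp_pair_simps(1-3)[of ?s ?t "Zero C P (Und X)" c]
        fp_pair_simps(1-3)[of ?s ?t p "?s \<cdot>\<^bsub>C\<^esub> p"] c(1-3) tc ts
        0[unfolded star_def] 1[unfolded star_def] by simp
    finally have "Cmp X n = c \<oplus>\<^bsub>C\<^esub> p" .
    then have "Cmp X n \<oplus>\<^bsub>C\<^esub> (?s \<cdot>\<^bsub>C\<^esub> p) = p \<oplus>\<^bsub>C\<^esub> (c \<oplus>\<^bsub>C\<^esub> (?s \<cdot>\<^bsub>C\<^esub> p))"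
      using c(1-3) by (simp add: add_ac)
    then show "Cmp X n \<oplus>\<^bsub>C\<^esub> (?s \<cdot>\<^bsub>C\<^esub> fp_fst C ?s ?t) = fp_fst C ?s ?t \<oplus>\<^bsub>C\<^esub> fp_snd C ?s ?t"
      using c(4) by (simp add: Ppq)
  qed (use X' X.bdry_lower in auto)
qed

section \<open>Direct sums, sequential colimits and images\<close>

context category
begin

lemma coproduct_universal:
  assumes "is_coproduct C I A S \<iota>" "Z \<in> Obj C" "\<And>i. i \<in> I \<Longrightarrow> f i \<in> Hom C (A i) Z"
  shows "\<exists>!h. h \<in> Hom C S Z \<and> (\<forall>i\<in>I. h \<cdot> \<iota> i = f i)"
proof -
  have "\<forall>Z \<in> Obj C. \<forall>f. (\<forall>i \<in> I. f i \<in> Hom C (A i) Z) \<longrightarrow>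
      (\<exists>!h. h \<in> Hom C S Z \<and> (\<forall>i \<in> I. h \<cdot> \<iota> i = f i))"
    using assms(1) by (simp add: is_coproduct_def)
  from this[rule_format, of Z f] assms(2,3) show ?thesis by blast
qed

lemma sequential_colimit_universal:
  assumes "is_sequential_colimit C D u X \<iota>" "Z \<in> Obj C"
    "\<And>n. f n \<in> Hom C (D n) Z" "\<And>n. f (Suc n) \<cdot> u n = f n"
  shows "\<exists>!h. h \<in> Hom C X Z \<and> (\<forall>n. h \<cdot> \<iota> n = f n)"
proof -
  have "\<forall>Z \<in> Obj C. \<forall>f. (\<forall>n. f n \<in> Hom C (D n) Z \<and> f (Suc n) \<cdot> u n = f n) \<longrightarrow>
      (\<exists>!h. h \<in> Hom C X Z \<and> (\<forall>n. h \<cdot> \<iota> n = f n))"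
    using assms(1) by (simp add: is_sequential_colimit_def)
  from this[rule_format, of Z f] assms(2-4) show ?thesis by blast
qed

lemma coproduct_ext:
  assumes "is_coproduct C I A S \<iota>" "h \<in> Arr C" "k \<in> Arr C" "Dom C h = S" "Dom C k = S"
    "Cod C k = Cod C h" "\<And>i. i \<in> I \<Longrightarrow> h \<cdot> \<iota> i = k \<cdot> \<iota> i"
  shows "h = k"
proof -
  have \<iota>: "\<iota> i \<in> Hom C (A i) S" if "i \<in> I" for i
    using assms(1) that by (simp add: is_coproduct_def)
  have "h \<cdot> \<iota> i \<in> Hom C (A i) (Cod C h)" if "i \<in> I" for i
    using \<iota>[OF that] assms(2,4) by (simp add: Hom_def)
  moreover have "Cod C h \<in> Obj C" using assms by simp
  ultimately have "\<exists>!g. g \<in> Hom C S (Cod C h) \<and> (\<forall>i\<in>I. g \<cdot> \<iota> i = h \<cdot> \<iota> i)"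
    by (intro coproduct_universal[OF assms(1)])
  moreover have "h \<in> Hom C S (Cod C h)" "k \<in> Hom C S (Cod C h)"
    using assms by (simp_all add: Hom_def)
  ultimately show ?thesis using assms(7) by metis
qed

lemma coproduct_desc:
  assumes "is_coproduct C I A S \<iota>" "Z \<in> Obj C" "\<And>i. i \<in> I \<Longrightarrow> f i \<in> Hom C (A i) Z"
  obtains h where "h \<in> Arr C" "Dom C h = S" "Cod C h = Z" "\<And>i. i \<in> I \<Longrightarrow> h \<cdot> \<iota> i = f i"
  using coproduct_universal[OF assms] that by (auto simp: Hom_def)

lemma split_mono:
  assumes "i \<in> Arr C" "p \<in> Arr C" "Dom C p = Cod C i" "Cod C p = Dom C i" "p \<cdot> i = Id C (Dom C i)"
  shows "is_mono C i"
  unfolding is_mono_def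
proof (intro conjI allI ballI impI)
  fix T f g
  assume fg: "f \<in> Hom C T (Dom C i)" "g \<in> Hom C T (Dom C i)" and eq: "i \<cdot> f = i \<cdot> g"
  have "p \<cdot> (i \<cdot> h) = h" if "h \<in> Hom C T (Dom C i)" for h
    using comp_reassoc[OF assms(5), of h] that assms by (simp add: Hom_def)
  then show "f = g" using fg eq by metis
qed (use assms in simp)

text \<open>For any factorisation \<open>e = m \<cdot> r\<close> one has
  \<open>i = e \<cdot> i = m \<cdot> (r \<cdot> i)\<close>, which gives minimality.\<close>

lemma split_is_image:
  assumes i: "i \<in> Hom C K X" and p: "p \<in> Hom C X K" and pi: "p \<cdot> i = Id C K" and ip: "i \<cdot> p = e"
  shows "is_image C e K i"
proof -
  have ip': "i \<in> Arr C" "Dom C i = K" "Cod C i = X" "p \<in> Arr C" "Dom C p = X" "Cod C p = K"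
    using i p by (auto simp: Hom_def)
  have e: "e \<in> Arr C" "Dom C e = X" "Cod C e = X" unfolding ip[symmetric] using ip' by simp_all
  have "e \<cdot> i = i" unfolding ip[symmetric] using ip' pi by simp
  then have u: "m \<cdot> (r \<cdot> i) = i" if "m \<in> Hom C J X" "r \<in> Hom C X J" "m \<cdot> r = e" for m r J
    using comp_reassoc[OF that(3), of i] that(1,2) ip' by (simp add: Hom_def)
  show ?thesis
    unfolding is_image_def
  proof (intro conjI allI ballI impI)
    show "i \<in> Hom C K (Cod C e)" using i e by simp
    show "is_mono C i" by (rule split_mono[of i p]) (use ip' pi in simp_all)
    show "\<exists>r\<in>Hom C (Dom C e) K. i \<cdot> r = e" using e p ip by auto
    show "\<exists>u\<in>Hom C K J. m \<cdot> u = i"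
      if "m \<in> Hom C J (Cod C e)" "r \<in> Hom C (Dom C e) J" "is_mono C m \<and> m \<cdot> r = e" for J m r
      by (rule bexI[of _ "r \<cdot> i"]) (use that e u ip' in \<open>simp_all add: Hom_def\<close>)
  qed
qed

end

text \<open>An image is known only through minimality. Compared with an explicit splitting,
  \<open>\<iota>\<close> factors through \<open>i\<close>, hence
  \<open>e \<cdot> \<iota> = \<iota>\<close>; cancelling the monomorphism \<open>\<iota>\<close> in
  \<open>\<iota> \<cdot> (r \<cdot> \<iota>) = \<iota>\<close> shows that \<open>r\<close> is a
  retraction.\<close>

lemma (in abelian_category) image_of_idempotent_splits:
  assumes e: "e \<in> Hom C X X" "e \<cdot> e = e" and im: "is_image C e D \<iota>"
  obtains r where "\<iota> \<in> Hom C D X" "r \<in> Hom C X D" "r \<cdot> \<iota> = Id C D" "\<iota> \<cdot> r = e"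
proof -
  obtain K i p where K: "K \<in> Obj C" "i \<in> Hom C K X" "p \<in> Hom C X K" "p \<cdot> i = Id C K" "i \<cdot> p = e"
    using idempotent_splits[OF e] by blast
  have ip: "i \<in> Arr C" "Dom C i = K" "Cod C i = X" "p \<in> Arr C" "Dom C p = X" "Cod C p = K"
    and e': "e \<in> Arr C" "Dom C e = X" "Cod C e = X"
    using K(2,3) e(1) by (auto simp: Hom_def)
  have \<iota>: "\<iota> \<in> Hom C D X" "is_mono C \<iota>" using im e' by (auto simp: is_image_def)
  obtain r where r: "r \<in> Hom C X D" "\<iota> \<cdot> r = e" using im e' by (auto simp: is_image_def)
  have \<iota>r: "\<iota> \<in> Arr C" "Dom C \<iota> = D" "Cod C \<iota> = X" "r \<in> Arr C" "Dom C r = X" "Cod C r = D"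
    using \<iota>(1) r(1) by (auto simp: Hom_def)
  have min: "\<And>J m' e'. m' \<in> Hom C J X \<Longrightarrow> e' \<in> Hom C X J \<Longrightarrow> is_mono C m' \<Longrightarrow> m' \<cdot> e' = e \<Longrightarrow>
      \<exists>u\<in>Hom C D J. m' \<cdot> u = \<iota>"
    using im e' unfolding is_image_def by auto
  have "is_mono C i" by (rule split_mono[of i p]) (use ip K in simp_all)
  from min[OF K(2,3) this K(5)] obtain u where u: "u \<in> Hom C D K" "i \<cdot> u = \<iota>" by blast
  have "e \<cdot> (i \<cdot> u) = i \<cdot> u"
    unfolding K(5)[symmetric] using u(1) ip comp_reassoc[OF K(4), of u] by (simp add: Hom_def)
  then have e\<iota>: "\<iota> \<cdot> (r \<cdot> \<iota>) = \<iota>"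
    using comp_reassoc[OF r(2), of \<iota>] \<iota>r u(2) by simp
  have "r \<cdot> \<iota> \<in> Hom C D D" "Id C D \<in> Hom C D D" "\<iota> \<cdot> Id C D = \<iota>"
    using \<iota>r Dom_Obj[of \<iota>] by (simp_all add: Hom_def)
  then have "r \<cdot> \<iota> = Id C D"
    using \<iota>(2) e\<iota> \<iota>r unfolding is_mono_def by metis
  then show thesis using that \<iota>(1) r by blast
qed

text \<open>As every \<open>s\<^sub>n\<close> is idempotent, a compatible family of morphisms on the images \<open>X\<^sub>n\<close> is a family
  of morphisms \<open>f\<^sub>n\<close> on \<open>X\<close> with \<open>f\<^sub>n s\<^sub>n = f\<^sub>n\<close>.\<close>

lemma (in linear_omega_category) exhaustive_iff:
  "(\<exists>D u \<iota>. (\<forall>n. is_image C (Src X n) (D n) (\<iota> n)) \<and> is_sequential_colimit C D u (Und X) \<iota>) \<longleftrightarrow>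
   (\<forall>Z\<in>Obj C. \<forall>f. (\<forall>n. f n \<in> Hom C (Und X) Z \<and> f n \<cdot> Src X n = f n \<and> f (Suc n) \<cdot> Src X n = f n) \<longrightarrow>
      (\<exists>!h. h \<in> Hom C (Und X) Z \<and> (\<forall>n. h \<cdot> Src X n = f n)))" (is "?L \<longleftrightarrow> ?R")
proof
  assume ?L
  then obtain D u \<iota> where im: "\<And>n. is_image C (Src X n) (D n) (\<iota> n)"
    and colim: "is_sequential_colimit C D u (Und X) \<iota>" by blast
  have "\<forall>n. \<exists>r. \<iota> n \<in> Hom C (D n) (Und X) \<and> r \<in> Hom C (Und X) (D n) \<and>
          r \<cdot> \<iota> n = Id C (D n) \<and> \<iota> n \<cdot> r = Src X n"
    using image_of_idempotent_splits[OF Src_Hom _ im] by (metis bdry_simps(1) order_refl)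
  then obtain r where r: "\<And>n. \<iota> n \<in> Hom C (D n) (Und X)" "\<And>n. r n \<in> Hom C (Und X) (D n)"
    "\<And>n. r n \<cdot> \<iota> n = Id C (D n)" "\<And>n. \<iota> n \<cdot> r n = Src X n" by metis
  have A: "\<iota> n \<in> Arr C" "Dom C (\<iota> n) = D n" "Cod C (\<iota> n) = Und X"
    "r n \<in> Arr C" "Dom C (r n) = Und X" "Cod C (r n) = D n" for n
    using r(1,2)[of n] by (auto simp: Hom_def)
  have s\<iota>: "Src X n \<cdot> \<iota> n = \<iota> n" for n
    unfolding r(4)[symmetric] using A r(3) by simp
  have u: "u n \<in> Arr C" "Dom C (u n) = D n" "Cod C (u n) = D (Suc n)" "\<iota> (Suc n) \<cdot> u n = \<iota> n" for n
    using colim by (auto simp: is_sequential_colimit_def Hom_def)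
  show ?R
  proof (intro ballI allI impI)
    fix Z f
    assume Z: "Z \<in> Obj C"
      and f: "\<forall>n. f n \<in> Hom C (Und X) Z \<and> f n \<cdot> Src X n = f n \<and> f (Suc n) \<cdot> Src X n = f n"
    have fA: "f n \<in> Arr C" "Dom C (f n) = Und X" "Cod C (f n) = Z" for n
      using f by (auto simp: Hom_def)
    have "f (Suc n) \<cdot> \<iota> n = f n \<cdot> \<iota> n" for n
      using comp_assoc[of "\<iota> n" "Src X n" "f (Suc n)"] A fA s\<iota> f by simp
    then have "f n \<cdot> \<iota> n \<in> Hom C (D n) Z" "(f (Suc n) \<cdot> \<iota> (Suc n)) \<cdot> u n = f n \<cdot> \<iota> n" for n
      using A fA u by (simp_all add: Hom_def)
    then have "\<exists>!h. h \<in> Hom C (Und X) Z \<and> (\<forall>n. h \<cdot> \<iota> n = f n \<cdot> \<iota> n)"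
      by (rule sequential_colimit_universal[OF colim Z])
    \<comment> \<open>Composing with \<open>r n\<close> and with \<open>\<iota> n\<close> passes
      back and forth between arrows on the image and arrows on \<open>X\<close> that absorb
      \<open>s\<^sub>n\<close>.\<close>
    moreover have "(h \<cdot> \<iota> n = f n \<cdot> \<iota> n) \<longleftrightarrow> (h \<cdot> Src X n = f n)" if "h \<in> Hom C (Und X) Z" for h n
    proof -
      have h: "h \<in> Arr C" "Dom C h = Und X" "Cod C h = Z" using that by (auto simp: Hom_def)
      have "g \<cdot> Src X n = (g \<cdot> \<iota> n) \<cdot> r n" "g \<cdot> \<iota> n = (g \<cdot> Src X n) \<cdot> \<iota> n"
        if "g \<in> Arr C" "Dom C g = Und X" for g
        using that A r(4) s\<iota> by simp_all
      then show ?thesis using h fA f by metis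
    qed
    ultimately show "\<exists>!h. h \<in> Hom C (Und X) Z \<and> (\<forall>n. h \<cdot> Src X n = f n)"
      by (smt (verit, best))
  qed
next
  assume R: ?R
  have "\<forall>n. \<exists>D i p. D \<in> Obj C \<and> i \<in> Hom C D (Und X) \<and> p \<in> Hom C (Und X) D \<and>
           p \<cdot> i = Id C D \<and> i \<cdot> p = Src X n"
    using idempotent_splits[OF Src_Hom] by (metis bdry_simps(1) order_refl)
  then obtain D \<iota> r where r: "\<And>n. D n \<in> Obj C" "\<And>n. \<iota> n \<in> Hom C (D n) (Und X)"
    "\<And>n. r n \<in> Hom C (Und X) (D n)" "\<And>n. r n \<cdot> \<iota> n = Id C (D n)" "\<And>n. \<iota> n \<cdot> r n = Src X n" by metis
  have A: "\<iota> n \<in> Arr C" "Dom C (\<iota> n) = D n" "Cod C (\<iota> n) = Und X"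
    "r n \<in> Arr C" "Dom C (r n) = Und X" "Cod C (r n) = D n" for n
    using r(2,3)[of n] by (auto simp: Hom_def)
  have s\<iota>: "Src X n \<cdot> \<iota> n = \<iota> n" for n
    unfolding r(5)[symmetric] using A r(4) by simp
  \<comment> \<open>The inclusion of one image into the next is read off by the next retraction; it
    commutes with the inclusions into \<open>X\<close> because
    \<open>s\<^sub>n\<^sub>+\<^sub>1 s\<^sub>n = s\<^sub>n\<close>.\<close>
  define u where "u n = r (Suc n) \<cdot> \<iota> n" for n
  have u: "u n \<in> Hom C (D n) (D (Suc n))" for n
    using A by (simp add: u_def Hom_def)
  have \<iota>u: "\<iota> (Suc n) \<cdot> u n = \<iota> n" for n
  proof -
    have "\<iota> (Suc n) \<cdot> u n = Src X (Suc n) \<cdot> (Src X n \<cdot> \<iota> n)"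
      unfolding u_def s\<iota> using comp_reassoc[OF r(5)[of "Suc n"], of "\<iota> n"] A by simp
    also have "\<dots> = \<iota> n" using bdry_comp_simps(1)[of "\<iota> n" n "Suc n"] A s\<iota> by simp
    finally show ?thesis .
  qed
  have "is_sequential_colimit C D u (Und X) \<iota>"
    unfolding is_sequential_colimit_def
  proof (intro conjI allI ballI impI)
    fix Z g
    assume Z: "Z \<in> Obj C" and g: "\<forall>n. g n \<in> Hom C (D n) Z \<and> g (Suc n) \<cdot> u n = g n"
    have gA: "g n \<in> Arr C" "Dom C (g n) = D n" "Cod C (g n) = Z" for n
      using g by (auto simp: Hom_def)
    have "(g n \<cdot> r n) \<cdot> Src X n = g n \<cdot> r n" for n
    proof -
      have "(g n \<cdot> r n) \<cdot> Src X n = g n \<cdot> ((r n \<cdot> \<iota> n) \<cdot> r n)"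
        unfolding r(5)[symmetric] using A gA by simp
      then show ?thesis using A gA r(1,4) by simp
    qed
    moreover have "(g (Suc n) \<cdot> r (Suc n)) \<cdot> Src X n = g n \<cdot> r n" for n
    proof -
      have "(g (Suc n) \<cdot> r (Suc n)) \<cdot> Src X n = (g (Suc n) \<cdot> u n) \<cdot> r n"
        unfolding r(5)[symmetric] u_def using A gA by simp
      then show ?thesis using g by simp
    qed
    ultimately have "\<exists>!h. h \<in> Hom C (Und X) Z \<and> (\<forall>n. h \<cdot> Src X n = g n \<cdot> r n)"
      using R[rule_format, OF Z, of "\<lambda>n. g n \<cdot> r n"] A gA by (simp add: Hom_def)
    moreover have "(h \<cdot> \<iota> n = g n) \<longleftrightarrow> (h \<cdot> Src X n = g n \<cdot> r n)" if "h \<in> Hom C (Und X) Z" for h n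
    proof -
      have h: "h \<in> Arr C" "Dom C h = Und X" "Cod C h = Z" using that by (auto simp: Hom_def)
      have "h \<cdot> Src X n = (h \<cdot> \<iota> n) \<cdot> r n" "h \<cdot> \<iota> n = (h \<cdot> Src X n) \<cdot> \<iota> n"
        "(g n \<cdot> r n) \<cdot> \<iota> n = g n"
        using h A gA r(1,4,5) s\<iota> by simp_all
      then show ?thesis by metis
    qed
    ultimately show "\<exists>!h. h \<in> Hom C (Und X) Z \<and> (\<forall>n. h \<cdot> \<iota> n = g n)"
      by (smt (verit, best))
  qed (use r(2) u \<iota>u Und_Obj in auto)
  then show ?L
    using split_is_image[OF r(2,3,4,5)] by blast
qed

section \<open>Decompositions of \<open>\<omega>\<close>-categories\<close>

definition cdeg :: "('o, 'm) complex_data \<Rightarrow> nat \<Rightarrow> 'o" where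
  "cdeg K n = Deg K (int n)"

text \<open>Indexed by the target degree: \<open>cdiff K n\<close> runs from degree
  \<open>n + 1\<close> to degree \<open>n\<close>, which makes it the component belonging to
  \<open>t\<^sub>n\<close>.\<close>

definition cdiff :: "('o, 'm) complex_data \<Rightarrow> nat \<Rightarrow> 'm" where
  "cdiff K n = Diff K (int (Suc n))"

text \<open>The boundaries are prescribed summand by summand; \<open>s\<^sub>n\<close> and
  \<open>t\<^sub>n\<close> can differ only on degree \<open>n + 1\<close>. Compositions do not
  occur, as the linear form fixes them.\<close>

definition is_decomposition ::
  "('o, 'm, 'z) preadditive_scheme \<Rightarrow> ('o, 'm) omega_data \<Rightarrow> ('o, 'm) complex_data \<Rightarrow> (nat \<Rightarrow> 'm) \<Rightarrow> bool"
where
  "is_decomposition C X K i \<longleftrightarrow>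
     is_coproduct C UNIV (cdeg K) (Und X) i \<and>
     (\<forall>n k. k \<le> n \<longrightarrow> Src X n \<cdot>\<^bsub>C\<^esub> i k = i k \<and> Tgt X n \<cdot>\<^bsub>C\<^esub> i k = i k) \<and>
     (\<forall>n k. n < k \<longrightarrow> Src X n \<cdot>\<^bsub>C\<^esub> i k = Zero C (cdeg K k) (Und X)) \<and>
     (\<forall>n k. Suc n < k \<longrightarrow> Tgt X n \<cdot>\<^bsub>C\<^esub> i k = Zero C (cdeg K k) (Und X)) \<and>
     (\<forall>n. Tgt X n \<cdot>\<^bsub>C\<^esub> i (Suc n) = i n \<cdot>\<^bsub>C\<^esub> cdiff K n)"

section \<open>Complexes as sequences indexed by natural numbers\<close>

context abelian_category
begin

lemma nonneg_complex_cdiff: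
  assumes "nonneg_complex C K"
  shows "cdeg K n \<in> Obj C" "cdiff K n \<in> Arr C" "Dom C (cdiff K n) = cdeg K (Suc n)"
    "Cod C (cdiff K n) = cdeg K n" "cdiff K n \<cdot> cdiff K (Suc n) = Zero C (cdeg K (Suc (Suc n))) (cdeg K n)"
proof -
  have K: "\<And>k. Deg K k \<in> Obj C" "\<And>k. Diff K k \<in> Hom C (Deg K k) (Deg K (k - 1))"
    "\<And>k. Diff K (k - 1) \<cdot> Diff K k = Zero C (Deg K k) (Deg K (k - 2))"
    using assms by (auto simp: nonneg_complex_def chain_complex_def)
  show "cdeg K n \<in> Obj C" "cdiff K n \<in> Arr C" "Dom C (cdiff K n) = cdeg K (Suc n)"
    "Cod C (cdiff K n) = cdeg K n"
    using K(1)[of "int n"] K(2)[of "int (Suc n)"] by (auto simp: cdiff_def cdeg_def Hom_def)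
  show "cdiff K n \<cdot> cdiff K (Suc n) = Zero C (cdeg K (Suc (Suc n))) (cdeg K n)"
    using K(3)[of "int (Suc (Suc n))"] by (simp add: cdiff_def cdeg_def add.commute)
qed

lemma nonneg_complex_exists:
  assumes A: "\<And>n. A n \<in> Obj C" and d: "\<And>n. d n \<in> Hom C (A (Suc n)) (A n)"
    and dd: "\<And>n. d n \<cdot> d (Suc n) = Zero C (A (Suc (Suc n))) (A n)"
  shows "\<exists>K. nonneg_complex C K \<and> (\<forall>n. cdeg K n = A n) \<and> (\<forall>n. cdiff K n = d n)"
proof -
  obtain Z where Z: "is_zero_object C Z" using has_zero_object by blast
  define D where "D k = (if k < 0 then Z else A (nat k))" for k
  define \<delta> where "\<delta> k = (if k \<le> 0 then Zero C (D k) (D (k - 1)) else d (nat (k - 1)))" for k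
  have D [simp]: "D k \<in> Obj C" for k using A Z by (auto simp: D_def is_zero_object_def)
  have \<delta>: "\<delta> k \<in> Hom C (D k) (D (k - 1))" for k
  proof (cases "k \<le> 0")
    case False
    then have "nat k = Suc (nat (k - 1))" by simp
    then show ?thesis using False d[of "nat (k - 1)"] by (simp add: \<delta>_def D_def)
  qed (simp add: \<delta>_def Hom_def)
  then have \<delta>' [simp]: "\<delta> k \<in> Arr C" "Dom C (\<delta> k) = D k" "Cod C (\<delta> k) = D (k - 1)" for k
    by (auto simp: Hom_def)
  \<comment> \<open>For \<open>k \<le> 1\<close> the target has negative degree and is a zero
    object; the hypothesis \<open>dd\<close> covers the remaining degrees.\<close>
  have \<delta>\<delta>: "\<delta> (k - 1) \<cdot> \<delta> k = Zero C (D k) (D (k - 2))" for k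
  proof (cases "k \<le> 1")
    case True
    then show ?thesis
      using Z D[of k] D[of "k - 2"] \<delta>'[of k] \<delta>'[of "k - 1"]
      by (intro Hom_zero_object(2)[of Z _ "D k"]) (simp_all add: Hom_def D_def[of "k - 2"])
  next
    case False
    then have "nat (k - 1) = Suc (nat (k - 2))" "nat k = Suc (Suc (nat (k - 2)))" by simp_all
    then show ?thesis using False dd[of "nat (k - 2)"] by (simp add: \<delta>_def D_def)
  qed
  define K where "K = \<lparr>Deg = D, Diff = \<delta>\<rparr>"
  have "nonneg_complex C K"
    using Z \<delta> \<delta>\<delta> by (simp add: K_def nonneg_complex_def chain_complex_def) (simp add: D_def)
  moreover have "cdeg K n = A n" "cdiff K n = d n" for n
    by (simp_all add: K_def D_def \<delta>_def cdiff_def cdeg_def)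
  ultimately show ?thesis by blast
qed

end

text \<open>The boundaries are assumed to be endomorphisms but no axiom of an \<omega>-category is:
  the locale also serves to derive those axioms for the object built from a complex.\<close>

locale decomposition = abelian_category C
  for C :: "('o, 'm, 'z) preadditive_scheme" (structure) and X :: "('o, 'm) omega_data"
    and K :: "('o, 'm) complex_data" and i :: "nat \<Rightarrow> 'm" +
  assumes nonneg: "nonneg_complex C K" and decomp: "is_decomposition C X K i"
    and bdry_Hom: "Src X n \<in> Hom C (Und X) (Und X)" "Tgt X n \<in> Hom C (Und X) (Und X)"
begin

lemmas cdiff [simp] = nonneg_complex_cdiff[OF nonneg]

lemma coproduct: "is_coproduct C UNIV (cdeg K) (Und X) i"
  using decomp by (simp add: is_decomposition_def)

lemma inj_simps [simp]:
  "Und X \<in> Obj C" "i n \<in> Arr C" "Dom C (i n) = cdeg K n" "Cod C (i n) = Und X"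
  "Src X n \<in> Arr C" "Dom C (Src X n) = Und X" "Cod C (Src X n) = Und X"
  "Tgt X n \<in> Arr C" "Dom C (Tgt X n) = Und X" "Cod C (Tgt X n) = Und X"
  using coproduct bdry_Hom[of n] by (auto simp: is_coproduct_def Hom_def)

lemma bdry_inj [simp]:
  "k \<le> n \<Longrightarrow> Src X n \<cdot> i k = i k" "k \<le> n \<Longrightarrow> Tgt X n \<cdot> i k = i k"
  "n < k \<Longrightarrow> Src X n \<cdot> i k = Zero C (cdeg K k) (Und X)"
  "Suc n < k \<Longrightarrow> Tgt X n \<cdot> i k = Zero C (cdeg K k) (Und X)"
  "Tgt X n \<cdot> i (Suc n) = i n \<cdot> cdiff K n"
  using decomp by (simp_all add: is_decomposition_def)

lemma bdry_inj_comp [simp]: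
  assumes "a \<in> Arr C" "Cod C a = cdeg K k"
  shows "k \<le> n \<Longrightarrow> Src X n \<cdot> (i k \<cdot> a) = i k \<cdot> a" "k \<le> n \<Longrightarrow> Tgt X n \<cdot> (i k \<cdot> a) = i k \<cdot> a"
    "n < k \<Longrightarrow> Src X n \<cdot> (i k \<cdot> a) = Zero C (Dom C a) (Und X)"
    "Suc n < k \<Longrightarrow> Tgt X n \<cdot> (i k \<cdot> a) = Zero C (Dom C a) (Und X)"
    "k = Suc n \<Longrightarrow> Tgt X n \<cdot> (i k \<cdot> a) = i n \<cdot> (cdiff K n \<cdot> a)"
proof -
  show "k \<le> n \<Longrightarrow> Src X n \<cdot> (i k \<cdot> a) = i k \<cdot> a" "k \<le> n \<Longrightarrow> Tgt X n \<cdot> (i k \<cdot> a) = i k \<cdot> a"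
    using assms by (auto intro: comp_reassoc)
  show "n < k \<Longrightarrow> Src X n \<cdot> (i k \<cdot> a) = Zero C (Dom C a) (Und X)"
    "Suc n < k \<Longrightarrow> Tgt X n \<cdot> (i k \<cdot> a) = Zero C (Dom C a) (Und X)"
    using comp_reassoc[of "Src X n" "i k" "Zero C (cdeg K k) (Und X)" a]
      comp_reassoc[of "Tgt X n" "i k" "Zero C (cdeg K k) (Und X)" a] assms by simp_all
  show "k = Suc n \<Longrightarrow> Tgt X n \<cdot> (i k \<cdot> a) = i n \<cdot> (cdiff K n \<cdot> a)"
    using comp_reassoc[OF bdry_inj(5)[of n], of a] assms by simp
qed

lemma ext:
  assumes "h \<in> Arr C" "k \<in> Arr C" "Dom C h = Und X" "Dom C k = Und X"
    "Cod C k = Cod C h" "\<And>n. h \<cdot> i n = k \<cdot> i n"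
  shows "h = k"
  using coproduct_ext[OF coproduct] assms by blast

text \<open>A direct sum governs arrows out of it. The projections, given by Kronecker families,
  give a hold on arrows into it: they make every \<open>i n\<close> a split monomorphism.\<close>

definition proj :: "nat \<Rightarrow> 'm" where
  "proj n = (SOME p. p \<in> Hom C (Und X) (cdeg K n) \<and>
     (\<forall>k. p \<cdot> i k = (if k = n then Id C (cdeg K n) else Zero C (cdeg K k) (cdeg K n))))"

lemma proj [simp]:
  "proj n \<in> Arr C" "Dom C (proj n) = Und X" "Cod C (proj n) = cdeg K n"
  "proj n \<cdot> i n = Id C (cdeg K n)" "k \<noteq> n \<Longrightarrow> proj n \<cdot> i k = Zero C (cdeg K k) (cdeg K n)"
proof -
  have "\<exists>p. p \<in> Hom C (Und X) (cdeg K n) \<and>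
     (\<forall>k. p \<cdot> i k = (if k = n then Id C (cdeg K n) else Zero C (cdeg K k) (cdeg K n)))"
    by (rule coproduct_desc[OF coproduct, of "cdeg K n"
          "\<lambda>k. if k = n then Id C (cdeg K n) else Zero C (cdeg K k) (cdeg K n)"])
      (auto simp: Hom_def)
  from someI_ex[OF this, folded proj_def]
  show "proj n \<in> Arr C" "Dom C (proj n) = Und X" "Cod C (proj n) = cdeg K n"
    "proj n \<cdot> i n = Id C (cdeg K n)" "k \<noteq> n \<Longrightarrow> proj n \<cdot> i k = Zero C (cdeg K k) (cdeg K n)"
    by (auto simp: Hom_def)
qed

lemma proj_comp [simp]:
  assumes "a \<in> Arr C"
  shows "Cod C a = cdeg K n \<Longrightarrow> proj n \<cdot> (i n \<cdot> a) = a"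
  using comp_reassoc[of "proj n" "i n" "Id C (cdeg K n)" a] assms by simp

lemma inj_cancel:
  assumes "i n \<cdot> a = i n \<cdot> b" "a \<in> Arr C" "b \<in> Arr C" "Cod C a = cdeg K n" "Cod C b = cdeg K n"
  shows "a = b"
  using arg_cong[OF assms(1), of "\<lambda>x. proj n \<cdot> x"] assms(2-5) by simp

text \<open>Together with \<open>Src_Suc\<close> this makes \<open>s\<^sub>n\<close> the partial sum
  of the idempotents \<open>i k \<cdot> proj k\<close>, which later shows in which degree an arrow
  into the sum lands.\<close>

lemma Src_0: "Src X 0 = i 0 \<cdot> proj 0"
proof (rule ext)
  show "Src X 0 \<cdot> i n = (i 0 \<cdot> proj 0) \<cdot> i n" for n by (cases "n = 0") simp_all
qed simp_all

lemma Src_Suc: "Src X (Suc m) = (i (Suc m) \<cdot> proj (Suc m)) \<oplus> Src X m"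
proof (rule ext)
  show "Src X (Suc m) \<cdot> i n = ((i (Suc m) \<cdot> proj (Suc m)) \<oplus> Src X m) \<cdot> i n" for n
    by (cases n "Suc m" rule: linorder_cases) simp_all
qed simp_all

text \<open>\<open>\<sigma>\<close> takes values in degrees at most \<open>m\<close>, where both
  boundaries of dimension \<open>n\<close> are the identity.\<close>

lemma bdry_upper:
  assumes "m \<le> n" "\<rho> \<in> {Src X n, Tgt X n}" "\<sigma> \<in> {Src X m, Tgt X m}"
  shows "\<rho> \<cdot> \<sigma> = \<sigma>"
proof (rule ext)
  show "(\<rho> \<cdot> \<sigma>) \<cdot> i k = \<sigma> \<cdot> i k" for k
    using assms by (cases k "Suc m" rule: linorder_cases) auto
qed (use assms in auto)

lemma bdry_lower:
  assumes "m < n" "\<rho> \<in> {Src X n, Tgt X n}" "\<sigma> \<in> {Src X m, Tgt X m}"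
  shows "\<sigma> \<cdot> \<rho> = \<sigma>"
proof (rule ext)
  \<comment> \<open>The critical case is \<open>\<rho> = t\<^sub>n\<close> on degree
    \<open>n + 1\<close>. For \<open>n = m + 1\<close> it requires \<open>d d = 0\<close>, because
    \<open>t\<^sub>m\<close> applies the differential a second time.\<close>
  have "Tgt X m \<cdot> (i n \<cdot> cdiff K n) = Zero C (cdeg K (Suc n)) (Und X)"
  proof (cases "n = Suc m")
    case False
    then show ?thesis using \<open>m < n\<close> by simp
  qed simp
  then show "(\<sigma> \<cdot> \<rho>) \<cdot> i k = \<sigma> \<cdot> i k" for k
    using assms by (cases k "Suc n" rule: linorder_cases) auto
qed (use assms in auto)

lemma exhaustive:
  assumes Z: "Z \<in> Obj C"
    and f: "\<And>n. f n \<in> Hom C (Und X) Z" "\<And>n. f n \<cdot> Src X n = f n" "\<And>n. f (Suc n) \<cdot> Src X n = f n"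
  shows "\<exists>!h. h \<in> Hom C (Und X) Z \<and> (\<forall>n. h \<cdot> Src X n = f n)"
proof -
  have fA: "f n \<in> Arr C" "Dom C (f n) = Und X" "Cod C (f n) = Z" for n
    using f(1) by (auto simp: Hom_def)
  \<comment> \<open>On degree \<open>k\<close> the family is constant from index \<open>k\<close>
    on, so \<open>f n \<cdot> i n\<close> is the only candidate for
    \<open>h \<cdot> i n\<close>.\<close>
  have f_le: "f (k + m) \<cdot> i k = f k \<cdot> i k" for k m
  proof (induction m)
    case (Suc m)
    have "f (Suc (k + m)) \<cdot> i k = (f (Suc (k + m)) \<cdot> Src X (k + m)) \<cdot> i k"
      using fA by simp
    then show ?case using Suc f(3) by simp
  qed simp
  obtain h where h: "h \<in> Arr C" "Dom C h = Und X" "Cod C h = Z" "\<And>n. h \<cdot> i n = f n \<cdot> i n"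
    by (rule coproduct_desc[OF coproduct Z, of "\<lambda>n. f n \<cdot> i n"]) (use fA in \<open>auto simp: Hom_def\<close>)
  have "h \<cdot> Src X n = f n" for n
  proof (rule ext)
    fix k
    show "(h \<cdot> Src X n) \<cdot> i k = f n \<cdot> i k"
    proof (cases "k \<le> n")
      case True
      then show ?thesis using h f_le[of k "n - k"] by simp
    next
      case False
      \<comment> \<open>Above degree \<open>n\<close> both sides vanish, since \<open>f n\<close>
        absorbs \<open>s\<^sub>n\<close>.\<close>
      then have "(f n \<cdot> Src X n) \<cdot> i k = Zero C (cdeg K k) Z" using fA Z by simp
      then show ?thesis using False h f(2) Z by simp
    qed
  qed (use fA h in auto)
  moreover have "g = h" if "g \<in> Hom C (Und X) Z" "\<forall>n. g \<cdot> Src X n = f n" for g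
  proof (rule ext)
    show "g \<cdot> i n = h \<cdot> i n" for n
    proof -
      have "g \<cdot> i n = (g \<cdot> Src X n) \<cdot> i n" using that(1) by (simp add: Hom_def)
      then show ?thesis using that h by simp
    qed
  qed (use that(1) h(1-3) in \<open>simp_all add: Hom_def\<close>)
  moreover have "h \<in> Hom C (Und X) Z" using h(1-3) by (simp add: Hom_def)
  ultimately show ?thesis by blast
qed

end

section \<open>Passage between complexes and \<omega>-categories\<close>

lemma (in abelian_category) omega_category_of_complex:
  assumes K: "nonneg_complex C K" and S: "is_coproduct C UNIV (cdeg K) S i"
  shows "\<exists>X. omega_category C X \<and> is_decomposition C X K i"
proof -
  note [simp] = nonneg_complex_cdiff[OF K]
  have [simp]: "S \<in> Obj C" "i n \<in> Arr C" "Dom C (i n) = cdeg K n" "Cod C (i n) = S" for n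
    using S by (auto simp: is_coproduct_def Hom_def)
  have "\<exists>s. s \<in> Hom C S S \<and> (\<forall>k. s \<cdot> i k = (if k \<le> n then i k else Zero C (cdeg K k) S))" for n
    by (rule coproduct_desc[OF S, of S "\<lambda>k. if k \<le> n then i k else Zero C (cdeg K k) S"])
      (auto simp: Hom_def)
  then obtain s where s: "\<And>n. s n \<in> Hom C S S"
    "\<And>n k. s n \<cdot> i k = (if k \<le> n then i k else Zero C (cdeg K k) S)" by metis
  have "\<exists>t. t \<in> Hom C S S \<and> (\<forall>k. t \<cdot> i k = (if k \<le> n then i k else
          if k = Suc n then i n \<cdot> cdiff K n else Zero C (cdeg K k) S))" for n
    by (rule coproduct_desc[OF S, of S "\<lambda>k. if k \<le> n then i k else
          if k = Suc n then i n \<cdot> cdiff K n else Zero C (cdeg K k) S"])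
      (auto simp: Hom_def)
  then obtain t where t: "\<And>n. t n \<in> Hom C S S"
    "\<And>n k. t n \<cdot> i k = (if k \<le> n then i k else
          if k = Suc n then i n \<cdot> cdiff K n else Zero C (cdeg K k) S)" by metis
  have st [simp]: "s n \<in> Arr C" "Dom C (s n) = S" "Cod C (s n) = S"
    "t n \<in> Arr C" "Dom C (t n) = S" "Cod C (t n) = S" for n
    using s(1)[of n] t(1)[of n] by (auto simp: Hom_def)
  note fp [simp] = fp_simps[of "s n" "t n" for n, simplified]
  \<comment> \<open>In terms of the two projections \<open>p\<close> and \<open>q\<close>, the
    composition is \<open>p + q - s\<^sub>n p\<close>, as the linear form dictates.\<close>
  have "\<exists>c. c \<in> Arr C \<and> Dom C c = fp_obj C (s n) (t n) \<and> Cod C c = S \<and>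
     c \<oplus> (s n \<cdot> fp_fst C (s n) (t n)) = fp_fst C (s n) (t n) \<oplus> fp_snd C (s n) (t n)" for n
    using difference_exists[of "fp_fst C (s n) (t n) \<oplus> fp_snd C (s n) (t n)" "s n \<cdot> fp_fst C (s n) (t n)"]
    by simp
  then obtain c where c: "\<And>n. c n \<in> Hom C (fp_obj C (s n) (t n)) S"
    "\<And>n. c n \<oplus> (s n \<cdot> fp_fst C (s n) (t n)) = fp_fst C (s n) (t n) \<oplus> fp_snd C (s n) (t n)"
    unfolding Hom_def by (atomize_elim, unfold all_conj_distrib[symmetric], intro choice) auto
  define X where "X = \<lparr>Und = S, Src = s, Tgt = t, Cmp = c\<rparr>"
  have X: "is_decomposition C X K i" using S s(2) t(2) by (simp add: is_decomposition_def X_def)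
  interpret D: decomposition C X K i
    by unfold_locales (use K X s(1) t(1) in \<open>auto simp: X_def\<close>)
  interpret L: linear_omega_category C X
    by unfold_locales (use D.bdry_upper D.bdry_lower c in \<open>auto simp: X_def Hom_def\<close>)
  have "omega_category C X"
    by (rule L.omega_categoryI, unfold L.exhaustive_iff) (use D.exhaustive in blast)
  then show ?thesis using X by blast
qed

text \<open>The summands are the images of the orthogonal idempotents \<open>s\<^sub>0\<close> and \<open>s\<^sub>n\<^sub>+\<^sub>1 - s\<^sub>n\<close>, with
  differential induced by \<open>t\<^sub>n\<close>.\<close>

lemma (in linear_omega_category) decomposition_exists:
  assumes exh: "\<And>Z f. Z \<in> Obj C \<Longrightarrow>
      (\<And>n. f n \<in> Hom C (Und X) Z \<and> f n \<cdot> Src X n = f n \<and> f (Suc n) \<cdot> Src X n = f n) \<Longrightarrow>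
      \<exists>!h. h \<in> Hom C (Und X) Z \<and> (\<forall>n. h \<cdot> Src X n = f n)"
  shows "\<exists>K i. nonneg_complex C K \<and> is_decomposition C X K i"
proof -
  let ?s = "Src X" and ?t = "Tgt X" and ?Z = "Zero C (Und X) (Und X)"
  have "\<exists>d. d \<in> Arr C \<and> Dom C d = Und X \<and> Cod C d = Und X \<and> d \<oplus> ?s n = ?s (Suc n)" for n
    using difference_exists[of "?s (Suc n)" "?s n"] by simp
  then obtain d where d: "\<And>n. d n \<in> Arr C" "\<And>n. Dom C (d n) = Und X" "\<And>n. Cod C (d n) = Und X"
    "\<And>n. d n \<oplus> ?s n = ?s (Suc n)" by metis
  \<comment> \<open>\<open>e n\<close> is \<open>s\<^sub>n - s\<^sub>n\<^sub>-\<^sub>1\<close>, with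
    the convention \<open>s\<^sub>-\<^sub>1 = 0\<close>.\<close>
  define e where "e n = (case n of 0 \<Rightarrow> ?s 0 | Suc m \<Rightarrow> d m)" for n
  have e [simp]: "e n \<in> Arr C" "Dom C (e n) = Und X" "Cod C (e n) = Und X" for n
    using d by (auto simp: e_def split: nat.split)
  have e_0: "e 0 = ?s 0" by (simp add: e_def)
  have e_Suc: "e (Suc m) \<oplus> ?s m = ?s (Suc m)" for m using d(4) by (simp add: e_def)
  have left: "\<rho> \<cdot> e n = e n" if "n \<le> m" "\<rho> \<in> {?s m, ?t m}" for n m \<rho>
  proof (cases n)
    case 0
    then show ?thesis using that by (auto simp: e_0)
  next
    case (Suc k)
    have "\<rho> \<cdot> (e n \<oplus> ?s k) = e n \<oplus> ?s k"
      using that unfolding Suc e_Suc by auto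
    then have "(\<rho> \<cdot> e n) \<oplus> ?s k = e n \<oplus> ?s k" using that Suc by auto
    then show ?thesis
      using that by (intro add_right_cancel[of "\<rho> \<cdot> e n" "e n" "?s k"]) auto
  qed
  \<comment> \<open>A boundary that absorbs both \<open>s\<^sub>k\<close> and
    \<open>s\<^sub>k\<^sub>+\<^sub>1\<close> on its right kills their difference.\<close>
  have left0: "\<rho> \<cdot> e (Suc k) = ?Z" if "\<rho> \<cdot> ?s (Suc k) = \<rho>" "\<rho> \<cdot> ?s k = \<rho>" "\<rho> \<in> {?s m, ?t m}" for m k \<rho>
  proof -
    have "\<rho> \<cdot> (e (Suc k) \<oplus> ?s k) = \<rho> \<cdot> ?s (Suc k)" unfolding e_Suc ..
    then have "(\<rho> \<cdot> e (Suc k)) \<oplus> \<rho> = \<rho>" using that by auto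
    then show ?thesis using add_left_eq_self[of "\<rho> \<cdot> e (Suc k)" \<rho> "Und X" "Und X"] that(3) by auto
  qed
  have s_e: "?s m \<cdot> e n = (if n \<le> m then e n else ?Z)" for m n
    using left[of n m] left0[of "?s m" "n - 1" m] by (cases n; cases "m = n - 1") auto
  \<comment> \<open>The index \<open>n = m + 1\<close> is excluded because there
    \<open>t\<^sub>m\<close> acts as the differential.\<close>
  have t_e: "?t m \<cdot> e n = (if n \<le> m then e n else ?Z)" if "n \<noteq> Suc m" for m n
    using left[of n m] left0[of "?t m" "n - 1" m] that by (cases n) auto
  have e_comp: "e (Suc k) \<cdot> \<sigma> = ?Z" if "m \<le> k" "\<sigma> \<in> {?s m, ?t m}" for k m \<sigma>
  proof -
    have "(e (Suc k) \<oplus> ?s k) \<cdot> \<sigma> = \<sigma>" using that unfolding e_Suc by auto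
    then have "(e (Suc k) \<cdot> \<sigma>) \<oplus> \<sigma> = \<sigma>" using that by auto
    then show ?thesis using add_left_eq_self[of "e (Suc k) \<cdot> \<sigma>" \<sigma> "Und X" "Und X"] that(2) by auto
  qed
  \<comment> \<open>For \<open>n > 0\<close> the product is
    \<open>s\<^sub>n e\<^sub>m - s\<^sub>n\<^sub>-\<^sub>1 e\<^sub>m\<close>, where each term is
    \<open>e\<^sub>m\<close> or \<open>0\<close>.\<close>
  have ee: "e n \<cdot> e m = (if n = m then e n else ?Z)" for n m
  proof (cases n)
    case 0
    then show ?thesis using s_e[of 0 m] by (simp add: e_0)
  next
    case (Suc k)
    have "(e n \<cdot> e m) \<oplus> (?s k \<cdot> e m) = ?s n \<cdot> e m"
      using comp_add(1)[of "e n" "?s k" "e m"] e_Suc[of k] Suc by simp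
    note E = this[unfolded s_e]
    show ?thesis
    proof (cases "m \<le> k")
      case True
      then have "(e n \<cdot> e m) \<oplus> e m = e m" using E Suc by simp
      then have "e n \<cdot> e m = ?Z" by (subst (asm) add_left_eq_self) simp_all
      then show ?thesis using True Suc by simp
    next
      case False
      then have "e n \<cdot> e m = (if m \<le> n then e m else ?Z)" using E by simp
      then show ?thesis using False Suc by (cases "m = n") simp_all
    qed
  qed
  have "\<forall>n. \<exists>D i p. D \<in> Obj C \<and> i \<in> Hom C D (Und X) \<and> p \<in> Hom C (Und X) D \<and>
           p \<cdot> i = Id C D \<and> i \<cdot> p = e n"
  proof
    fix n
    have "e n \<in> Hom C (Und X) (Und X)" "e n \<cdot> e n = e n" by (simp_all add: Hom_def ee)
    then show "\<exists>D i p. D \<in> Obj C \<and> i \<in> Hom C D (Und X) \<and> p \<in> Hom C (Und X) D \<and>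
        p \<cdot> i = Id C D \<and> i \<cdot> p = e n"
      by (rule idempotent_splits) blast
  qed
  then obtain A i p where A [simp]: "\<And>n. A n \<in> Obj C"
    and ip: "\<And>n. i n \<in> Hom C (A n) (Und X)" "\<And>n. p n \<in> Hom C (Und X) (A n)"
    and pi: "\<And>n. p n \<cdot> i n = Id C (A n)" and ip_e: "\<And>n. i n \<cdot> p n = e n" by metis
  have ip' [simp]: "i n \<in> Arr C" "Dom C (i n) = A n" "Cod C (i n) = Und X"
    "p n \<in> Arr C" "Dom C (p n) = Und X" "Cod C (p n) = A n" for n
    using ip[of n] by (auto simp: Hom_def)
  have ei: "e n \<cdot> i n = i n" for n unfolding ip_e[symmetric] by (simp add: pi)
  have pe: "p n \<cdot> e n = p n" for n
    unfolding ip_e[symmetric] using comp_reassoc[OF pi[of n], of "p n"] by simp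
  have via_e: "\<rho> \<cdot> i n = (\<rho> \<cdot> e n) \<cdot> i n" if "\<rho> \<in> Arr C" "Dom C \<rho> = Und X" for \<rho> n
    using that by (simp add: ei)
  have s_i: "?s m \<cdot> i n = (if n \<le> m then i n else Zero C (A n) (Und X))" for m n
    using via_e[of "?s m" n] by (simp add: s_e ei)
  have t_i: "?t m \<cdot> i n = (if n \<le> m then i n else Zero C (A n) (Und X))" if "n \<noteq> Suc m" for m n
    using via_e[of "?t m" n] that by (simp add: t_e ei)
  have p_s: "p (Suc n) \<cdot> ?s n = Zero C (Und X) (A (Suc n))" for n
    using comp_assoc[of "?s n" "e (Suc n)" "p (Suc n)"] e_comp[of n n "?s n"] by (simp add: pe)
  have pi0: "p m \<cdot> i n = Zero C (A n) (A m)" if "m \<noteq> n" for m n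
  proof -
    have "p m \<cdot> i n = (p m \<cdot> (e m \<cdot> e n)) \<cdot> i n"
      by (simp add: ei comp_reassoc[OF pe] del: comp_assoc) (simp add: ei pe comp_reassoc[OF pe])
    then show ?thesis using that by (simp add: ee)
  qed
  define \<delta> where "\<delta> n = p n \<cdot> (?t n \<cdot> i (Suc n))" for n
  have \<delta> [simp]: "\<delta> n \<in> Arr C" "Dom C (\<delta> n) = A (Suc n)" "Cod C (\<delta> n) = A n" for n
    by (simp_all add: \<delta>_def)
  \<comment> \<open>\<open>t\<^sub>n\<close> maps summand \<open>n + 1\<close> into summand
    \<open>n\<close>: its values are fixed by \<open>s\<^sub>n\<close>, and
    \<open>s\<^sub>n\<^sub>-\<^sub>1 t\<^sub>n = s\<^sub>n\<^sub>-\<^sub>1\<close> kills summand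
    \<open>n + 1\<close>.\<close>
  have i\<delta>: "i n \<cdot> \<delta> n = ?t n \<cdot> i (Suc n)" for n
  proof -
    have "i n \<cdot> \<delta> n = e n \<cdot> (?t n \<cdot> i (Suc n))"
      unfolding \<delta>_def using comp_reassoc[OF ip_e[of n], of "?t n \<cdot> i (Suc n)"] by simp
    also have "\<dots> = ?t n \<cdot> i (Suc n)"
    proof (cases n)
      case 0
      then show ?thesis by (simp add: e_0)
    next
      case (Suc k)
      have "(e n \<cdot> (?t n \<cdot> i (Suc n))) \<oplus> (?s k \<cdot> (?t n \<cdot> i (Suc n))) = ?s n \<cdot> (?t n \<cdot> i (Suc n))"
        using comp_add(1)[of "e n" "?s k" "?t n \<cdot> i (Suc n)"] e_Suc[of k] Suc by simp
      moreover have "?s k \<cdot> (?t n \<cdot> i (Suc n)) = Zero C (A (Suc n)) (Und X)"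
        using Suc by (simp add: s_i)
      ultimately show ?thesis by simp
    qed
    finally show ?thesis .
  qed
  \<comment> \<open>The composite reduces to
    \<open>t\<^sub>n t\<^sub>n\<^sub>+\<^sub>1 = t\<^sub>n\<close> on degree \<open>n + 2\<close>,
    where \<open>t\<^sub>n\<close> vanishes.\<close>
  have "\<delta> n \<cdot> \<delta> (Suc n) = Zero C (A (Suc (Suc n))) (A n)" for n
  proof -
    have "\<delta> n \<cdot> \<delta> (Suc n) = p n \<cdot> (?t n \<cdot> (i (Suc n) \<cdot> \<delta> (Suc n)))" by (simp add: \<delta>_def[of n])
    also have "\<dots> = p n \<cdot> (?t n \<cdot> i (Suc (Suc n)))" unfolding i\<delta> by simp
    finally show ?thesis by (simp add: t_i)
  qed
  then obtain K where K: "nonneg_complex C K" "\<And>n. cdeg K n = A n" "\<And>n. cdiff K n = \<delta> n"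
    using nonneg_complex_exists[of A \<delta>] by (auto simp: Hom_def)
  have "is_coproduct C UNIV (cdeg K) (Und X) i"
    unfolding is_coproduct_def K(2)
  proof (intro conjI ballI allI impI)
    fix Z g
    assume Z [simp]: "Z \<in> Obj C" and "\<forall>n\<in>UNIV. g n \<in> Hom C (A n) Z"
    then have g [simp]: "g n \<in> Arr C" "Dom C (g n) = A n" "Cod C (g n) = Z" for n
      by (auto simp: Hom_def)
    \<comment> \<open>Partial sums of the arrows \<open>g k \<cdot> p k\<close>; they form a
      compatible family, which \<open>exh\<close> glues to the required arrow.\<close>
    define f where "f = rec_nat (g 0 \<cdot> p 0) (\<lambda>n h. h \<oplus> (g (Suc n) \<cdot> p (Suc n)))"
    have f_0: "f 0 = g 0 \<cdot> p 0" and f_Suc: "f (Suc n) = f n \<oplus> (g (Suc n) \<cdot> p (Suc n))" for n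
      by (simp_all add: f_def)
    have f [simp]: "f n \<in> Arr C \<and> Dom C (f n) = Und X \<and> Cod C (f n) = Z" for n
      by (induction n) (simp_all add: f_0 f_Suc)
    have p_s': "p n \<cdot> ?s m = p n" if "n \<le> m" for n m
    proof -
      have "e n \<cdot> ?s m = e n"
      proof (cases n)
        case (Suc k)
        have "(e n \<cdot> ?s m) \<oplus> (?s k \<cdot> ?s m) = ?s n \<cdot> ?s m"
          using comp_add(1)[of "e n" "?s k" "?s m"] e_Suc[of k] Suc by simp
        moreover have "?s k \<cdot> ?s m = ?s k" "?s n \<cdot> ?s m = e n \<oplus> ?s k"
          using that Suc e_Suc[of k] by (cases "n = m"; simp)+
        ultimately show ?thesis
          using add_right_cancel[of "e n \<cdot> ?s m" "e n" "?s k"] by simp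
      qed (cases "m = 0"; simp add: e_0)
      then show ?thesis using comp_assoc[of "?s m" "e n" "p n"] by (simp add: pe)
    qed
    have fs: "f n \<cdot> ?s m = f n" if "n \<le> m" for n m
      using that by (induction n) (simp_all add: f_0 f_Suc p_s')
    moreover have "f (Suc n) \<cdot> ?s n = f n" for n
      using fs[of n n] by (simp add: f_Suc p_s)
    ultimately obtain h where h: "h \<in> Hom C (Und X) Z" "\<And>n. h \<cdot> ?s n = f n"
      using exh[OF Z, of f] by (auto simp: Hom_def)
    then have h' [simp]: "h \<in> Arr C" "Dom C h = Und X" "Cod C h = Z" by (auto simp: Hom_def)
    have f_i0: "f m \<cdot> i n = Zero C (A n) Z" if "m < n" for m n
      using that by (induction m) (simp_all add: f_0 f_Suc pi0)
    have f_i: "f n \<cdot> i n = g n" for n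
      by (cases n) (simp_all add: f_0 f_Suc pi f_i0)
    have "h \<cdot> i n = g n" for n
    proof -
      have "h \<cdot> i n = (h \<cdot> ?s n) \<cdot> i n" by (simp add: s_i)
      then show ?thesis unfolding h(2) f_i .
    qed
    moreover have "k = h" if "k \<in> Hom C (Und X) Z" "\<forall>n\<in>UNIV. k \<cdot> i n = g n" for k
    proof -
      have k [simp]: "k \<in> Arr C" "Dom C k = Und X" "Cod C k = Z" using that(1) by (auto simp: Hom_def)
      \<comment> \<open>Any competitor has the same partial sums, so uniqueness reduces to
        \<open>exh\<close> as well.\<close>
      have k_e: "k \<cdot> e n = g n \<cdot> p n" for n
        using comp_assoc[of "p n" "i n" k] that(2) by (simp add: ip_e)
      have "k \<cdot> ?s n = f n" for n
      proof (induction n)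
        case 0
        then show ?case using k_e[of 0] by (simp add: e_0 f_0)
      next
        case (Suc n)
        have "k \<cdot> ?s (Suc n) = (k \<cdot> e (Suc n)) \<oplus> (k \<cdot> ?s n)"
          unfolding e_Suc[symmetric] by simp
        then show ?case unfolding Suc k_e f_Suc by (simp add: add_commute)
      qed
      moreover have "\<exists>!h. h \<in> Hom C (Und X) Z \<and> (\<forall>n. h \<cdot> ?s n = f n)"
        using exh[OF Z, of f] h fs by (simp add: Hom_def f_Suc p_s)
      ultimately show ?thesis using h that(1) by blast
    qed
    ultimately show "\<exists>!h. h \<in> Hom C (Und X) Z \<and> (\<forall>n\<in>UNIV. h \<cdot> i n = g n)"
      using h(1) by blast
  qed (use ip Und_Obj in auto)
  then have "is_decomposition C X K i"
    unfolding is_decomposition_def K(2,3) i\<delta> by (simp add: s_i t_i)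
  then show ?thesis using K(1) by blast
qed

section \<open>Morphisms\<close>

text \<open>An additive map that commutes with sources carries \<open>a + b - s\<^sub>n a\<close> to
  the corresponding expression; commuting with targets as well keeps pairs composable.\<close>

lemma omega_map_iff:
  assumes "linear_omega_category C X" "linear_omega_category C Y"
  shows "omega_map C X Y f \<longleftrightarrow> f \<in> Hom C (Und X) (Und Y) \<and>
     (\<forall>n. f \<cdot>\<^bsub>C\<^esub> Src X n = Src Y n \<cdot>\<^bsub>C\<^esub> f) \<and> (\<forall>n. f \<cdot>\<^bsub>C\<^esub> Tgt X n = Tgt Y n \<cdot>\<^bsub>C\<^esub> f)"
    (is "_ \<longleftrightarrow> ?R")
proof
  interpret X: linear_omega_category C X by fact
  interpret Y: linear_omega_category C Y by fact
  assume R: ?R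
  then have [simp]: "f \<in> Arr C" "Dom C f = Und X" "Cod C f = Und Y" by (auto simp: Hom_def)
  have "f \<cdot>\<^bsub>C\<^esub> Cmp X n = star C Y n (f \<cdot>\<^bsub>C\<^esub> fp_fst C (Src X n) (Tgt X n)) (f \<cdot>\<^bsub>C\<^esub> fp_snd C (Src X n) (Tgt X n))"
    for n
  proof (rule Y.star_eqI[symmetric])
    let ?p = "fp_fst C (Src X n) (Tgt X n)" and ?q = "fp_snd C (Src X n) (Tgt X n)"
    note [simp] = X.bdry_fp X.Cmp_simps
    have comm: "Src Y n \<cdot>\<^bsub>C\<^esub> f = f \<cdot>\<^bsub>C\<^esub> Src X n" "Tgt Y n \<cdot>\<^bsub>C\<^esub> f = f \<cdot>\<^bsub>C\<^esub> Tgt X n"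
      using R by simp_all
    have s: "Src Y n \<cdot>\<^bsub>C\<^esub> (f \<cdot>\<^bsub>C\<^esub> ?p) = f \<cdot>\<^bsub>C\<^esub> (Src X n \<cdot>\<^bsub>C\<^esub> ?p)"
      using X.comp_reassoc[OF comm(1), of ?p] by simp
    have t: "Tgt Y n \<cdot>\<^bsub>C\<^esub> (f \<cdot>\<^bsub>C\<^esub> ?q) = f \<cdot>\<^bsub>C\<^esub> (Tgt X n \<cdot>\<^bsub>C\<^esub> ?q)"
      using X.comp_reassoc[OF comm(2), of ?q] by simp
    show "composable C Y n (f \<cdot>\<^bsub>C\<^esub> ?p) (f \<cdot>\<^bsub>C\<^esub> ?q)"
      unfolding Y.composable_iff s t using X.fp_comm[of "Src X n" "Tgt X n"] by simp
    have "f \<cdot>\<^bsub>C\<^esub> (Cmp X n \<oplus>\<^bsub>C\<^esub> (Src X n \<cdot>\<^bsub>C\<^esub> ?p)) = f \<cdot>\<^bsub>C\<^esub> (?p \<oplus>\<^bsub>C\<^esub> ?q)"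
      unfolding X.Cmp_add ..
    then show "(f \<cdot>\<^bsub>C\<^esub> Cmp X n) \<oplus>\<^bsub>C\<^esub> (Src Y n \<cdot>\<^bsub>C\<^esub> (f \<cdot>\<^bsub>C\<^esub> ?p)) = (f \<cdot>\<^bsub>C\<^esub> ?p) \<oplus>\<^bsub>C\<^esub> (f \<cdot>\<^bsub>C\<^esub> ?q)"
      unfolding s by simp
  qed (simp_all add: X.bdry_fp X.Cmp_simps)
  then show "omega_map C X Y f" using R by (simp add: omega_map_def)
qed (simp add: omega_map_def)

lemma (in abelian_category) chain_map_cdiff:
  assumes "chain_map C K L \<phi>" "nonneg_complex C K" "nonneg_complex C L"
  shows "\<phi> (int n) \<in> Hom C (cdeg K n) (cdeg L n)"
    "\<phi> (int n) \<cdot> cdiff K n = cdiff L n \<cdot> \<phi> (int (Suc n))"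
proof -
  have \<phi>: "\<And>k. \<phi> k \<in> Hom C (Deg K k) (Deg L k)" "\<And>k. \<phi> (k - 1) \<cdot> Diff K k = Diff L k \<cdot> \<phi> k"
    using assms(1) by (auto simp: chain_map_def)
  show "\<phi> (int n) \<in> Hom C (cdeg K n) (cdeg L n)" using \<phi>(1) by (simp add: cdeg_def)
  show "\<phi> (int n) \<cdot> cdiff K n = cdiff L n \<cdot> \<phi> (int (Suc n))"
    using \<phi>(2)[of "int (Suc n)"] by (simp add: cdiff_def)
qed

text \<open>In negative degrees parallel arrows coincide, being arrows into a zero object, so the
  components in degrees \<open>n \<ge> 0\<close> determine everything.\<close>

lemma (in abelian_category) chain_map_exists1:
  assumes K: "nonneg_complex C K" and L: "nonneg_complex C L"
    and \<phi>: "\<And>n. \<phi> n \<in> Hom C (cdeg K n) (cdeg L n)" "\<And>n. \<phi> n \<cdot> cdiff K n = cdiff L n \<cdot> \<phi> (Suc n)"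
  shows "\<exists>!\<psi>. chain_map C K L \<psi> \<and> (\<forall>n. \<psi> (int n) = \<phi> n)"
proof (rule ex1I)
  define \<psi> where "\<psi> k = (if k < 0 then Zero C (Deg K k) (Deg L k) else \<phi> (nat k))" for k
  have K': "\<And>k. Deg K k \<in> Obj C" "\<And>k. Diff K k \<in> Hom C (Deg K k) (Deg K (k - 1))"
    "\<And>k. k < 0 \<Longrightarrow> is_zero_object C (Deg K k)"
    and L': "\<And>k. Deg L k \<in> Obj C" "\<And>k. Diff L k \<in> Hom C (Deg L k) (Deg L (k - 1))"
    "\<And>k. k < 0 \<Longrightarrow> is_zero_object C (Deg L k)"
    using K L by (auto simp: nonneg_complex_def chain_complex_def)
  have \<psi>: "\<psi> k \<in> Hom C (Deg K k) (Deg L k)" for k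
    using \<phi>(1)[of "nat k"] K'(1)[of k] L'(1)[of k] by (auto simp: \<psi>_def cdeg_def Hom_def)
  \<comment> \<open>For \<open>k \<le> 0\<close>, degree \<open>0\<close> included, the square ends
    in the negative degree \<open>k - 1\<close>, hence in a zero object.\<close>
  have "\<psi> (k - 1) \<cdot> Diff K k = Diff L k \<cdot> \<psi> k" for k
  proof (cases "k \<le> 0")
    case True
    then show ?thesis
      using Comp_Hom[OF K'(2)[of k] \<psi>[of "k - 1"]] Comp_Hom[OF \<psi>[of k] L'(2)[of k]]
        Hom_zero_object(2)[OF L'(3)[of "k - 1"]] by simp
  next
    case False
    define n where "n = nat (k - 1)"
    have k: "k = int (Suc n)" and "\<psi> (k - 1) = \<phi> n" "\<psi> k = \<phi> (Suc n)"
      using False by (simp_all add: n_def \<psi>_def Suc_nat_eq_nat_zadd1)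
    then show ?thesis using \<phi>(2)[of n, unfolded cdiff_def, folded k] by simp
  qed
  then show "chain_map C K L \<psi> \<and> (\<forall>n. \<psi> (int n) = \<phi> n)"
    using \<psi> by (simp add: chain_map_def) (simp add: \<psi>_def)
  fix \<chi> assume \<chi>: "chain_map C K L \<chi> \<and> (\<forall>n. \<chi> (int n) = \<phi> n)"
  show "\<chi> = \<psi>"
  proof
    fix k
    show "\<chi> k = \<psi> k"
    proof (cases "k < 0")
      case True
      then show ?thesis
        using Hom_zero_object(2)[OF L'(3)[of k]] \<psi>[of k] \<chi> by (auto simp: chain_map_def)
    next
      case False
      then show ?thesis using \<chi> spec[of "\<lambda>n. \<chi> (int n) = \<phi> n" "nat k"] by (simp add: \<psi>_def)
    qed
  qed
qed

section \<open>Morphisms compared on summands\<close>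

locale decomposition_pair = X: decomposition C X K i + Y: decomposition C Y L j
  for C :: "('o, 'm, 'z) preadditive_scheme" (structure) and X K i Y L j
begin

text \<open>The arrow is defined on summands by \<open>j n \<cdot> \<phi> (int n)\<close> and all
  equations are compared there; the chain map condition enters for \<open>t\<^sub>n\<close> on
  degree \<open>n + 1\<close>.\<close>

lemma map_of_chain_map:
  assumes \<phi>: "chain_map C K L \<phi>"
  shows "\<exists>!f. f \<in> Hom C (Und X) (Und Y) \<and>
     (\<forall>n. f \<cdot> Src X n = Src Y n \<cdot> f) \<and> (\<forall>n. f \<cdot> Tgt X n = Tgt Y n \<cdot> f) \<and>
     (\<forall>n. f \<cdot> i n = j n \<cdot> \<phi> (int n))"
proof -
  note \<phi>n = X.chain_map_cdiff[OF \<phi> X.nonneg Y.nonneg]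
  define \<psi> where "\<psi> n = \<phi> (int n)" for n
  have \<psi> [simp]: "\<psi> n \<in> Arr C" "Dom C (\<psi> n) = cdeg K n" "Cod C (\<psi> n) = cdeg L n" for n
    using \<phi>n(1)[of n] by (auto simp: \<psi>_def Hom_def)
  have d: "\<psi> n \<cdot> cdiff K n = cdiff L n \<cdot> \<psi> (Suc n)" for n
    using \<phi>n(2) by (simp add: \<psi>_def)
  obtain f where f [simp]: "f \<in> Arr C" "Dom C f = Und X" "Cod C f = Und Y"
    and f_i: "\<And>n. f \<cdot> i n = j n \<cdot> \<psi> n"
    by (rule X.coproduct_desc[OF X.coproduct, of "Und Y" "\<lambda>n. j n \<cdot> \<psi> n"]) (auto simp: Hom_def)
  have "f \<cdot> Src X n = Src Y n \<cdot> f" for n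
  proof (rule X.ext)
    show "(f \<cdot> Src X n) \<cdot> i k = (Src Y n \<cdot> f) \<cdot> i k" for k
      by (cases "k \<le> n") (simp_all add: f_i)
  qed simp_all
  moreover have "f \<cdot> Tgt X n = Tgt Y n \<cdot> f" for n
  proof (rule X.ext)
    have "f \<cdot> (i n \<cdot> cdiff K n) = j n \<cdot> (cdiff L n \<cdot> \<psi> (Suc n))"
      using X.comp_reassoc[OF f_i[of n], of "cdiff K n"] by (simp add: d)
    then show "(f \<cdot> Tgt X n) \<cdot> i k = (Tgt Y n \<cdot> f) \<cdot> i k" for k
      by (cases k "Suc n" rule: linorder_cases) (simp_all add: f_i)
  qed simp_all
  moreover have "g = f" if "g \<in> Hom C (Und X) (Und Y)" "\<forall>n. g \<cdot> i n = j n \<cdot> \<phi> (int n)" for g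
    by (rule X.ext) (use that f_i in \<open>simp_all add: Hom_def \<psi>_def\<close>)
  ultimately show ?thesis
    using f_i by (intro ex1I[of _ f]) (auto simp: Hom_def \<psi>_def)
qed

text \<open>\<open>f\<close> preserves degrees: \<open>f \<cdot> i n\<close> is fixed by
  \<open>s\<^sub>n\<close> and, for \<open>n > 0\<close>, killed by
  \<open>s\<^sub>n\<^sub>-\<^sub>1\<close>, so it lands in summand \<open>n\<close>. Comparing
  \<open>t\<^sub>n\<close> on degree \<open>n + 1\<close> and cancelling the split monomorphism
  \<open>j n\<close> gives the chain map condition.\<close>

lemma chain_map_of_map:
  assumes f: "f \<in> Hom C (Und X) (Und Y)"
    and s: "\<And>n. f \<cdot> Src X n = Src Y n \<cdot> f" and t: "\<And>n. f \<cdot> Tgt X n = Tgt Y n \<cdot> f"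
  shows "\<exists>!\<phi>. chain_map C K L \<phi> \<and> (\<forall>n. f \<cdot> i n = j n \<cdot> \<phi> (int n))"
proof -
  have [simp]: "f \<in> Arr C" "Dom C f = Und X" "Cod C f = Und Y" using f by (auto simp: Hom_def)
  define \<psi> where "\<psi> n = Y.proj n \<cdot> (f \<cdot> i n)" for n
  have \<psi> [simp]: "\<psi> n \<in> Arr C" "Dom C (\<psi> n) = cdeg K n" "Cod C (\<psi> n) = cdeg L n" for n
    by (simp_all add: \<psi>_def)
  have s': "Src Y m \<cdot> (f \<cdot> i n) = f \<cdot> (Src X m \<cdot> i n)" for m n
    using X.comp_reassoc[OF s[of m, symmetric], of "i n"] by simp
  have f_i: "f \<cdot> i n = j n \<cdot> \<psi> n" for n
  proof -
    have "f \<cdot> i n = Src Y n \<cdot> (f \<cdot> i n)" by (simp add: s')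
    also have "\<dots> = j n \<cdot> (Y.proj n \<cdot> (f \<cdot> i n))"
    proof (cases n)
      case 0
      then show ?thesis by (simp add: Y.Src_0)
    next
      case (Suc m)
      then show ?thesis by (simp add: Y.Src_Suc s')
    qed
    finally show ?thesis by (simp add: \<psi>_def)
  qed
  have d: "\<psi> n \<cdot> cdiff K n = cdiff L n \<cdot> \<psi> (Suc n)" for n
  proof (rule Y.inj_cancel)
    have "j n \<cdot> (\<psi> n \<cdot> cdiff K n) = f \<cdot> (i n \<cdot> cdiff K n)"
      using X.comp_reassoc[OF f_i[of n], of "cdiff K n"] by simp
    also have "\<dots> = (f \<cdot> Tgt X n) \<cdot> i (Suc n)" by simp
    also have "\<dots> = Tgt Y n \<cdot> (f \<cdot> i (Suc n))" unfolding t by simp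
    also have "\<dots> = j n \<cdot> (cdiff L n \<cdot> \<psi> (Suc n))" unfolding f_i by simp
    finally show "j n \<cdot> (\<psi> n \<cdot> cdiff K n) = j n \<cdot> (cdiff L n \<cdot> \<psi> (Suc n))" .
  qed simp_all
  have "(f \<cdot> i n = j n \<cdot> \<phi> (int n)) \<longleftrightarrow> (\<phi> (int n) = \<psi> n)" if "chain_map C K L \<phi>" for \<phi> n
    using Y.inj_cancel[of n "\<phi> (int n)" "\<psi> n"] X.chain_map_cdiff(1)[OF that X.nonneg Y.nonneg, of n]
    by (auto simp: f_i Hom_def)
  then have "(chain_map C K L \<phi> \<and> (\<forall>n. f \<cdot> i n = j n \<cdot> \<phi> (int n))) \<longleftrightarrow>
      (chain_map C K L \<phi> \<and> (\<forall>n. \<phi> (int n) = \<psi> n))" for \<phi>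
    by blast
  then show ?thesis
    using X.chain_map_exists1[OF X.nonneg Y.nonneg, of \<psi>] d by (simp add: Hom_def)
qed

end

section \<open>The two categories and their equivalence\<close>

lemma Hom_Ch_iff:
  "\<Phi> \<in> Hom (Ch_nonneg C) K L \<longleftrightarrow> (\<exists>\<phi>. \<Phi> = Arrow K L \<phi> \<and> nonneg_complex C K \<and> nonneg_complex C L \<and>
     chain_map C K L \<phi>)"
  by (cases \<Phi>) (auto simp: Hom_def Ch_nonneg_def)

lemma Hom_Omega_iff:
  "F \<in> Hom (Omega_Cat C) X Y \<longleftrightarrow> (\<exists>f. F = Arrow X Y f \<and> omega_category C X \<and> omega_category C Y \<and>
     omega_map C X Y f)"
  by (cases F) (auto simp: Hom_def Omega_Cat_def)

lemma Ch_simps [simp]: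
  "Obj (Ch_nonneg C) = {K. nonneg_complex C K}"
  "Id (Ch_nonneg C) K = Arrow K K (\<lambda>k. Id C (Deg K k))"
  "Arrow L N \<psi> \<cdot>\<^bsub>Ch_nonneg C\<^esub> Arrow K L' \<phi> = Arrow K N (\<lambda>k. \<psi> k \<cdot>\<^bsub>C\<^esub> \<phi> k)"
  by (simp_all add: Ch_nonneg_def)

lemma Omega_simps [simp]:
  "Obj (Omega_Cat C) = {X. omega_category C X}"
  "Id (Omega_Cat C) X = Arrow X X (Id C (Und X))"
  "Arrow Y V g \<cdot>\<^bsub>Omega_Cat C\<^esub> Arrow X Y' f = Arrow X V (g \<cdot>\<^bsub>C\<^esub> f)"
  by (simp_all add: Omega_Cat_def)

context abelian_category
begin

lemma category_Ch_nonneg: "category (Ch_nonneg C)"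
proof
  have cm: "\<phi> k \<in> Arr C" "Dom C (\<phi> k) = Deg K k" "Cod C (\<phi> k) = Deg L k"
    "\<phi> (k - 1) \<cdot> Diff K k = Diff L k \<cdot> \<phi> k" if "chain_map C K L \<phi>" for K L \<phi> k
    using that by (auto simp: chain_map_def Hom_def)
  have cx: "Deg K k \<in> Obj C" "Diff K k \<in> Arr C" "Dom C (Diff K k) = Deg K k" "Cod C (Diff K k) = Deg K (k - 1)"
    if "nonneg_complex C K" for K k
    using that by (auto simp: nonneg_complex_def chain_complex_def Hom_def)
  show "Dom (Ch_nonneg C) f \<in> Obj (Ch_nonneg C)" "Cod (Ch_nonneg C) f \<in> Obj (Ch_nonneg C)"
    if "f \<in> Arr (Ch_nonneg C)" for f
    using that by (auto simp: Ch_nonneg_def)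
  show "Id (Ch_nonneg C) K \<in> Hom (Ch_nonneg C) K K" if "K \<in> Obj (Ch_nonneg C)" for K
    using that cx[of K] unfolding Hom_Ch_iff by (auto simp: chain_map_def Hom_def)
  show "g \<cdot>\<^bsub>Ch_nonneg C\<^esub> f \<in> Hom (Ch_nonneg C) K N"
    if f: "f \<in> Hom (Ch_nonneg C) K L" and g: "g \<in> Hom (Ch_nonneg C) L N" for K L N f g
  proof -
    obtain \<phi> \<psi> where fg: "f = Arrow K L \<phi>" "g = Arrow L N \<psi>" "chain_map C K L \<phi>" "chain_map C L N \<psi>"
      and KLN: "nonneg_complex C K" "nonneg_complex C L" "nonneg_complex C N"
      using f g by (auto simp: Hom_Ch_iff)
    note [simp] = cm[OF fg(3)] cm[OF fg(4)] cx[OF KLN(1)] cx[OF KLN(2)] cx[OF KLN(3)]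
    have "\<psi> (k - 1) \<cdot> (Diff L k \<cdot> \<phi> k) = Diff N k \<cdot> (\<psi> k \<cdot> \<phi> k)" for k
      using comp_reassoc[of "\<psi> (k - 1)" "Diff L k" "Diff N k \<cdot> \<psi> k" "\<phi> k"] by simp
    then show ?thesis using KLN unfolding Hom_Ch_iff fg(1,2) by (auto simp: chain_map_def Hom_def)
  qed
  show "Id (Ch_nonneg C) L \<cdot>\<^bsub>Ch_nonneg C\<^esub> f = f" "f \<cdot>\<^bsub>Ch_nonneg C\<^esub> Id (Ch_nonneg C) K = f"
    if "f \<in> Hom (Ch_nonneg C) K L" for K L f
    using that cm by (auto simp: Hom_Ch_iff)
  show "(h \<cdot>\<^bsub>Ch_nonneg C\<^esub> g) \<cdot>\<^bsub>Ch_nonneg C\<^esub> f = h \<cdot>\<^bsub>Ch_nonneg C\<^esub> (g \<cdot>\<^bsub>Ch_nonneg C\<^esub> f)"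
    if "f \<in> Hom (Ch_nonneg C) K L" "g \<in> Hom (Ch_nonneg C) L N" "h \<in> Hom (Ch_nonneg C) N P" for K L N P f g h
    using that cm by (auto simp: Hom_Ch_iff)
qed

text \<open>Through \<open>omega_map_iff\<close> identities and composites are only checked against
  sources and targets, which avoids all calculation in fibered products.\<close>

lemma category_Omega_Cat: "category (Omega_Cat C)"
proof
  have lin: "linear_omega_category C X" if "omega_category C X" for X
    using linear_omega_categoryI[OF abelian_category_axioms that] .
  have om: "f \<in> Arr C" "Dom C f = Und X" "Cod C f = Und Y" if "omega_map C X Y f" for X Y f
    using that by (auto simp: omega_map_def Hom_def)
  have und: "Und X \<in> Obj C" "Src X n \<in> Arr C" "Dom C (Src X n) = Und X" "Cod C (Src X n) = Und X"
    "Tgt X n \<in> Arr C" "Dom C (Tgt X n) = Und X" "Cod C (Tgt X n) = Und X"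
    if "omega_category C X" for X n
    using linear_omega_category.und_simps[OF lin[OF that]] by auto
  show "Dom (Omega_Cat C) f \<in> Obj (Omega_Cat C)" "Cod (Omega_Cat C) f \<in> Obj (Omega_Cat C)"
    if "f \<in> Arr (Omega_Cat C)" for f
    using that by (auto simp: Omega_Cat_def)
  show "Id (Omega_Cat C) X \<in> Hom (Omega_Cat C) X X" if "X \<in> Obj (Omega_Cat C)" for X
    using that und[of X] lin[of X] by (simp add: Hom_Omega_iff omega_map_iff Id_Hom)
  show "g \<cdot>\<^bsub>Omega_Cat C\<^esub> f \<in> Hom (Omega_Cat C) X V"
    if f: "f \<in> Hom (Omega_Cat C) X Y" and g: "g \<in> Hom (Omega_Cat C) Y V" for X Y V f g
  proof -
    obtain \<phi> \<psi> where fg: "f = Arrow X Y \<phi>" "g = Arrow Y V \<psi>" "omega_map C X Y \<phi>" "omega_map C Y V \<psi>"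
      and XYV: "omega_category C X" "omega_category C Y" "omega_category C V"
      using f g by (auto simp: Hom_Omega_iff)
    note [simp] = om[OF fg(3)] om[OF fg(4)] und[OF XYV(1)] und[OF XYV(2)] und[OF XYV(3)]
    have comm: "\<phi> \<cdot> Src X n = Src Y n \<cdot> \<phi>" "\<phi> \<cdot> Tgt X n = Tgt Y n \<cdot> \<phi>"
      "\<psi> \<cdot> Src Y n = Src V n \<cdot> \<psi>" "\<psi> \<cdot> Tgt Y n = Tgt V n \<cdot> \<psi>" for n
      using fg(3,4) by (auto simp: omega_map_def)
    have "\<psi> \<cdot> (Src Y n \<cdot> \<phi>) = Src V n \<cdot> (\<psi> \<cdot> \<phi>)" "\<psi> \<cdot> (Tgt Y n \<cdot> \<phi>) = Tgt V n \<cdot> (\<psi> \<cdot> \<phi>)" for n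
      using comp_reassoc[OF comm(3)[of n], of \<phi>] comp_reassoc[OF comm(4)[of n], of \<phi>] by simp_all
    then have "omega_map C X V (\<psi> \<cdot> \<phi>)"
      unfolding omega_map_iff[OF lin[OF XYV(1)] lin[OF XYV(3)]] by (simp add: Hom_def comm)
    then show ?thesis using fg XYV by (auto simp: Hom_Omega_iff)
  qed
  show "Id (Omega_Cat C) Y \<cdot>\<^bsub>Omega_Cat C\<^esub> f = f" "f \<cdot>\<^bsub>Omega_Cat C\<^esub> Id (Omega_Cat C) X = f"
    if "f \<in> Hom (Omega_Cat C) X Y" for X Y f
    using that om by (auto simp: Hom_Omega_iff)
  show "(h \<cdot>\<^bsub>Omega_Cat C\<^esub> g) \<cdot>\<^bsub>Omega_Cat C\<^esub> f = h \<cdot>\<^bsub>Omega_Cat C\<^esub> (g \<cdot>\<^bsub>Omega_Cat C\<^esub> f)"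
    if "f \<in> Hom (Omega_Cat C) X Y" "g \<in> Hom (Omega_Cat C) Y U" "h \<in> Hom (Omega_Cat C) U V" for X Y U V f g h
    using that om by (auto simp: Hom_Omega_iff)
qed

text \<open>An infinite index type contains a copy of the natural numbers, so a sequence becomes a
  family indexed by the range of an injection \<open>e\<close>, where \<open>inv_into UNIV e\<close>
  undoes the reindexing.\<close>

lemma countable_coproduct:
  assumes "infinite (UNIV :: 'i set)" "has_direct_sums C TYPE('i)" "\<And>n. A n \<in> Obj C"
  shows "\<exists>S \<iota>. is_coproduct C (UNIV :: nat set) A S \<iota>"
proof -
  obtain e :: "nat \<Rightarrow> 'i" where e: "inj e"
    using infinite_countable_subset[OF assms(1)] by blast
  obtain S \<iota> where S: "is_coproduct C (range e) (A \<circ> inv_into UNIV e) S \<iota>"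
    using assms(2,3) unfolding has_direct_sums_def by (metis comp_apply)
  have "is_coproduct C UNIV A S (\<iota> \<circ> e)"
    unfolding is_coproduct_def
  proof (intro conjI ballI allI impI)
    show "S \<in> Obj C" "\<And>n. (\<iota> \<circ> e) n \<in> Hom C (A n) S"
      using S e by (auto simp: is_coproduct_def)
    fix Z f assume Z: "Z \<in> Obj C" and f: "\<forall>n\<in>UNIV. f n \<in> Hom C (A n) Z"
    have "\<exists>!h. h \<in> Hom C S Z \<and> (\<forall>k\<in>range e. h \<cdot> \<iota> k = (f \<circ> inv_into UNIV e) k)"
      by (rule coproduct_universal[OF S Z]) (use f in auto)
    then show "\<exists>!h. h \<in> Hom C S Z \<and> (\<forall>n\<in>UNIV. h \<cdot> (\<iota> \<circ> e) n = f n)"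
      using e by simp
  qed
  then show ?thesis by blast
qed

text \<open>The apex consists of the decompositions. Surjectivity of the legs is
  \<open>omega_category_of_complex\<close> and \<open>decomposition_exists\<close>; full
  faithfulness is \<open>map_of_chain_map\<close> and \<open>chain_map_of_map\<close>.\<close>

lemma equivalent_Ch_nonneg_Omega_Cat:
  assumes coprod: "\<And>A. (\<And>n. A n \<in> Obj C) \<Longrightarrow> \<exists>S \<iota>. is_coproduct C (UNIV :: nat set) A S \<iota>"
  shows "equivalent_categories (Ch_nonneg C) (Omega_Cat C)"
proof -
  let ?W = "{(K, X, i). nonneg_complex C K \<and> omega_category C X \<and> is_decomposition C X K i}"
  \<comment> \<open>Agreement is imposed in degrees \<open>n \<ge> 0\<close>; below them the
    components of a chain map are forced.\<close>
  let ?M = "\<lambda>(K, X, i) (L, Y, j) \<Phi> F. \<forall>n. amap F \<cdot> i n = j n \<cdot> amap \<Phi> (int n)"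
  have lin: "linear_omega_category C X" if "omega_category C X" for X
    using linear_omega_categoryI[OF abelian_category_axioms that] .
  have dec: "decomposition C X K i" if "(K, X, i) \<in> ?W" for K X i
    using that linear_omega_category.Src_Hom[OF lin] linear_omega_category.Tgt_Hom[OF lin]
    by (auto simp: decomposition_def decomposition_axioms_def abelian_category_axioms)
  have "category_span (Ch_nonneg C) (Omega_Cat C) ?W fst (fst \<circ> snd) ?M"
  proof (intro category_span.intro category_span_axioms.intro category_Ch_nonneg category_Omega_Cat)
    show "fst w \<in> Obj (Ch_nonneg C)" "(fst \<circ> snd) w \<in> Obj (Omega_Cat C)" if "w \<in> ?W" for w
      using that by auto
    show "\<exists>w\<in>?W. fst w = K" if "K \<in> Obj (Ch_nonneg C)" for K
    proof -
      have K: "nonneg_complex C K" using that by simp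
      obtain S i where "is_coproduct C UNIV (cdeg K) S i"
        using coprod[of "cdeg K"] nonneg_complex_cdiff(1)[OF K] by blast
      from omega_category_of_complex[OF K this] show ?thesis using K by auto
    qed
    show "\<exists>w\<in>?W. (fst \<circ> snd) w = X" if "X \<in> Obj (Omega_Cat C)" for X
    proof -
      have X: "omega_category C X" using that by simp
      interpret L: linear_omega_category C X by (rule lin[OF X])
      have "\<exists>K i. nonneg_complex C K \<and> is_decomposition C X K i"
        by (rule L.decomposition_exists)
          (use L.exhaustive_iff omega_category.exhaustive[OF X] in blast)
      then show ?thesis using X by auto
    qed
    show "\<exists>!F. F \<in> Hom (Omega_Cat C) ((fst \<circ> snd) v) ((fst \<circ> snd) w) \<and> ?M v w \<Phi> F"
      if vw: "v \<in> ?W" "w \<in> ?W" and \<Phi>: "\<Phi> \<in> Hom (Ch_nonneg C) (fst v) (fst w)" for v w \<Phi>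
    proof -
      obtain K X i L Y j where v: "v = (K, X, i)" and w: "w = (L, Y, j)" by (metis prod_cases3)
      interpret decomposition_pair C X K i Y L j
        using dec vw unfolding v w decomposition_pair_def by blast
      obtain \<phi> where \<phi>: "\<Phi> = Arrow K L \<phi>" "chain_map C K L \<phi>" using \<Phi> v w by (auto simp: Hom_Ch_iff)
      have XY: "omega_category C X" "omega_category C Y" using vw v w by auto
      obtain f where f: "omega_map C X Y f" "\<forall>n. f \<cdot> i n = j n \<cdot> \<phi> (int n)"
        and un: "\<And>g. omega_map C X Y g \<Longrightarrow> \<forall>n. g \<cdot> i n = j n \<cdot> \<phi> (int n) \<Longrightarrow> g = f"
        using map_of_chain_map[OF \<phi>(2)] unfolding omega_map_iff[OF lin[OF XY(1)] lin[OF XY(2)]]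
        by blast
      show ?thesis
        unfolding v w \<phi>(1)
      proof (rule ex1I[of _ "Arrow X Y f"])
        fix F assume "F \<in> Hom (Omega_Cat C) ((fst \<circ> snd) (K, X, i)) ((fst \<circ> snd) (L, Y, j)) \<and>
          ?M (K, X, i) (L, Y, j) (Arrow K L \<phi>) F"
        then obtain g where "F = Arrow X Y g" "omega_map C X Y g" "\<forall>n. g \<cdot> i n = j n \<cdot> \<phi> (int n)"
          by (auto simp: Hom_Omega_iff)
        then show "F = Arrow X Y f" using un by blast
      qed (use f XY in \<open>simp add: Hom_Omega_iff\<close>)
    qed
    show "\<exists>!\<Phi>. \<Phi> \<in> Hom (Ch_nonneg C) (fst v) (fst w) \<and> ?M v w \<Phi> F"
      if vw: "v \<in> ?W" "w \<in> ?W" and F: "F \<in> Hom (Omega_Cat C) ((fst \<circ> snd) v) ((fst \<circ> snd) w)" for v w F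
    proof -
      obtain K X i L Y j where v: "v = (K, X, i)" and w: "w = (L, Y, j)" by (metis prod_cases3)
      interpret decomposition_pair C X K i Y L j
        using dec vw unfolding v w decomposition_pair_def by blast
      obtain f where f: "F = Arrow X Y f" "omega_map C X Y f" using F v w by (auto simp: Hom_Omega_iff)
      have KL: "nonneg_complex C K" "nonneg_complex C L" using vw v w by auto
      obtain \<phi> where \<phi>: "chain_map C K L \<phi>" "\<forall>n. f \<cdot> i n = j n \<cdot> \<phi> (int n)"
        and un: "\<And>\<psi>. chain_map C K L \<psi> \<Longrightarrow> \<forall>n. f \<cdot> i n = j n \<cdot> \<psi> (int n) \<Longrightarrow> \<psi> = \<phi>"
        using chain_map_of_map[of f] f(2) unfolding omega_map_def by blast
      show ?thesis
        unfolding v w f(1)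
      proof (rule ex1I[of _ "Arrow K L \<phi>"])
        fix \<Phi> assume "\<Phi> \<in> Hom (Ch_nonneg C) (fst (K, X, i)) (fst (L, Y, j)) \<and>
          ?M (K, X, i) (L, Y, j) \<Phi> (Arrow X Y f)"
        then obtain \<psi> where "\<Phi> = Arrow K L \<psi>" "chain_map C K L \<psi>" "\<forall>n. f \<cdot> i n = j n \<cdot> \<psi> (int n)"
          by (auto simp: Hom_Ch_iff)
        then show "\<Phi> = Arrow K L \<phi>" using un by blast
      qed (use \<phi> KL in \<open>simp add: Hom_Ch_iff\<close>)
    qed
    show "?M w w (Id (Ch_nonneg C) (fst w)) (Id (Omega_Cat C) ((fst \<circ> snd) w))" if "w \<in> ?W" for w
    proof -
      obtain K X i where w: "w = (K, X, i)" by (metis prod_cases3)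
      interpret decomposition C X K i using dec that unfolding w by blast
      show ?thesis by (simp add: w cdeg_def[symmetric])
    qed
    show "?M u w (\<Psi> \<cdot>\<^bsub>Ch_nonneg C\<^esub> \<Phi>) (G \<cdot>\<^bsub>Omega_Cat C\<^esub> F)"
      if uvw: "u \<in> ?W" "v \<in> ?W" "w \<in> ?W"
        and \<Phi>: "\<Phi> \<in> Hom (Ch_nonneg C) (fst u) (fst v)"
        and F: "F \<in> Hom (Omega_Cat C) ((fst \<circ> snd) u) ((fst \<circ> snd) v)" and \<Phi>F: "?M u v \<Phi> F"
        and \<Psi>: "\<Psi> \<in> Hom (Ch_nonneg C) (fst v) (fst w)"
        and G: "G \<in> Hom (Omega_Cat C) ((fst \<circ> snd) v) ((fst \<circ> snd) w)" and \<Psi>G: "?M v w \<Psi> G"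
      for u v w \<Phi> F \<Psi> G
    proof -
      obtain K X i L Y j N V k where u: "u = (K, X, i)" and v: "v = (L, Y, j)" and w: "w = (N, V, k)"
        by (metis prod_cases3)
      interpret U: decomposition C X K i using dec uvw unfolding u by blast
      interpret V: decomposition C Y L j using dec uvw unfolding v by blast
      interpret W: decomposition C V N k using dec uvw unfolding w by blast
      obtain f g \<phi> \<psi> where maps: "F = Arrow X Y f" "G = Arrow Y V g" "\<Phi> = Arrow K L \<phi>" "\<Psi> = Arrow L N \<psi>"
        and fg: "omega_map C X Y f" "omega_map C Y V g" and \<phi>\<psi>: "chain_map C K L \<phi>" "chain_map C L N \<psi>"
        using F G \<Phi> \<Psi> u v w by (auto simp: Hom_Ch_iff Hom_Omega_iff)
      have [simp]: "f \<in> Arr C" "Dom C f = Und X" "Cod C f = Und Y"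
        "g \<in> Arr C" "Dom C g = Und Y" "Cod C g = Und V"
        using fg by (auto simp: omega_map_def Hom_def)
      have [simp]: "\<phi> (int n) \<in> Arr C" "Dom C (\<phi> (int n)) = cdeg K n" "Cod C (\<phi> (int n)) = cdeg L n"
        "\<psi> (int n) \<in> Arr C" "Dom C (\<psi> (int n)) = cdeg L n" "Cod C (\<psi> (int n)) = cdeg N n" for n
        using \<phi>\<psi> by (auto simp: chain_map_def Hom_def cdeg_def)
      have f_i: "f \<cdot> i n = j n \<cdot> \<phi> (int n)" and g_j: "g \<cdot> j n = k n \<cdot> \<psi> (int n)" for n
        using \<Phi>F \<Psi>G by (auto simp: u v w maps)
      have "(g \<cdot> f) \<cdot> i n = k n \<cdot> (\<psi> (int n) \<cdot> \<phi> (int n))" for n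
        using comp_reassoc[OF g_j[of n], of "\<phi> (int n)"] by (simp add: f_i)
      then show ?thesis by (simp add: u v w maps)
    qed
  qed
  then show ?thesis by (rule category_span.equivalent)
qed

end

theorem lemma3p20:
  fixes C :: "('o, 'm) preadditive"
  assumes "abelian_category C"
    and "infinite (UNIV :: 'i set)"
    and "has_direct_sums C TYPE('i)"
  shows "equivalent_categories (Ch_nonneg C) (Omega_Cat C)"
proof -
  interpret abelian_category C by fact
  show ?thesis
    by (rule equivalent_Ch_nonneg_Omega_Cat) (rule countable_coproduct[OF assms(2,3)])
qed

end
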